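(* Let $m\ge1$ be an integer and $s\in\mathbb{Z}$. Assume that the Riemann-Hilbert problem (X1)–(X3) described in the context is solvable, with solution $\boldsymbol{X}_m(z;s)$. Then $$E_{2m}^{(s)}E_{2m-1}^{(s)}E_{2m-2}^{(s)}\neq0.$$ Consequently, the polynomials $S_{2m}(z;s)$, $S_{2m-1}(z;s)$, $S_{2m-2}(z;s)$ exist and are unique. Moreover, the matrix $$\boldsymbol{B}_m(s):=\begin{pmatrix}S_{2m}(0;s)&S'_{2m}(0;s)&0\\S_{2m-1}(0;s)&S'_{2m-1}(0;s)&0\\S_{2m-2}(0;s)&S'_{2m-2}(0;s)&-2g^{(s)}_{2m-2}\end{pmatrix}$$ is well-defined and invertible; equivalently, $$\frac{E^{(s+1)}_{2m}\widehat{E}^{(s)}_{2m-1}-E^{(s+1)}_{2m-1}\widehat{E}^{(s)}_{2m}}{E^{(s)}_{2m}E^{(s)}_{2m-1}}\neq0.$$ Finally, the polynomials $S_n^*(z;s)$ together with the associated functions $H_n(z;s)$, for $n\in\{2m,2m-1,2m-2\}$, are characterized by the solution of the Riemann-Hilbert problem through $$\begin{pmatrix}S^*_{2m}(z;s)&\frac{1}{2z}\left(S^*_{2m}(z;s)-S^*_{2m}(-z;s)\right)&H_{2m}(z;s)\\ zS^*_{2m-1}(z;s)&\frac12\left(S^*_{2m-1}(z;s)+S^*_{2m-1}(-z;s)\right)&H_{2m-1}(z;s)\\ z^2S^*_{2m-2}(z;s)&\frac z2\left(S^*_{2m-2}(z;s)-S^*_{2m-2}(-z;s)\right)&H_{2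m-2}(z;s)\end{pmatrix}=\boldsymbol{B}_m(s)\boldsymbol{X}_m(z;s).$$
   Context: $\mathbb{T}$ is the unit circle, oriented counterclockwise; the subscripts $+$ and $-$ denote boundary values on $\mathbb{T}$ from the inside and the outside respectively. $w$ is a weight function (symbol) on $\mathbb{T}$, regular enough that the Plemelj–Sokhotskii formula holds (with continuous boundary values) for Cauchy transforms over $\mathbb{T}$ of $w$ times Laurent polynomials. Its moments are $w_\ell=\int_{\mathbb{T}} w(\zeta)\zeta^{-\ell}\frac{d\zeta}{2\pi \mathrm{i}\zeta}$, $\ell\in\mathbb{Z}$. The Riemann-Hilbert problem for $\boldsymbol{X}_m(z;s)$: (X1) $\boldsymbol{X}_m(\cdot;s):\mathbb{C}\setminus\mathbb{T}\to\mathbb{C}^{3\times3}$ is holomorphic. (X2) For $z\in\mathbb{T}$, $\boldsymbol{X}_{m,+}(z;s)=\boldsymbol{X}_{m,-}(z;s)\begin{pmatrix}1&0&k_1(z;m,s)\\0&1&k_2(z;m,s)\\0&0&1\end{pmatrix}$, where $k_1(z;m,s)=z^{-2m-s-2}\left[w(z)+(-1)^sw(-z)\right]$ and $k_2(z;m,s)=2(-1)^{s+1}z^{-2m-s-1}w(-z)$. (X3) As $z\to\infty$, $$\boldsymbol{X}_m(z;s)=\left(I+\frac{\overset{\infty}{\boldsymbol{X}}_1(m,s)}{z}+\frac{\overset{\infty}{\boldsymbol{X}}_2(m,s)}{z^2}+O(z^{-3})\right)\operatorname{diag}\left(z^{2m},z^{2m-2},z^{-4m+2}\right),$$ where $\overset{\infty}{\boldsymbol{X}}_1(m,s)$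 has $(2,1)$ entry $1$ and all other entries $0$. In addition, the third column satisfies $\boldsymbol{X}^{(3)}_m(z;s)=z^{-4m+2}\left(\boldsymbol{e}_3+\boldsymbol{\phi}z^{-2}+O(z^{-4})\right)$ as $z\to\infty$, with $\boldsymbol{e}_3=(0,0,1)^T$ and some constant vector $\boldsymbol{\phi}\in\mathbb{C}^3$; and, with $\boldsymbol{v}(z):=\boldsymbol{X}^{(1)}_m(z;s)$ the first column and $\boldsymbol{v}_j:=\frac{1}{j!}\frac{d^j}{dz^j}\boldsymbol{v}(0)$, $j=0,1,2$, $$\operatorname{rank}\begin{pmatrix}\boldsymbol{v}_0&\boldsymbol{e}_3&\boldsymbol{\phi}\end{pmatrix}=\operatorname{rank}\begin{pmatrix}\boldsymbol{v}_0&\boldsymbol{v}_1&\boldsymbol{e}_3\end{pmatrix}=\operatorname{rank}\begin{pmatrix}\boldsymbol{v}_0&\boldsymbol{v}_1&\boldsymbol{v}_2\end{pmatrix}=3.$$ Other notation. For $t\in\mathbb{Z}$, $E^{(t)}_n:=\det(w_{j-2k+t})_{0\le j,k\le n-1}$, with $E^{(t)}_0:=1$, and $g_n^{(s)}:=E^{(s)}_{n+1}/E^{(s)}_n$. $\widehat{E}^{(s)}_n:=\det(w_{a_j-2k+s})_{0\le j,k\le n-1}$ with $a_0=0$ and $a_j=j+1$ for $1\le j\le n-1$. $S_n(z;s)$ is the monic polynomial of degree $n$ with $\int_{\mathbb{T}}S_n(\zeta^{-1};s)\zeta^{2k-s}w(\zeta)\frac{d\zeta}{2\pi \mathrm{i}\zeta}=0$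 for $k=0,\dots,n-1$ (it exists and is unique if $E^{(s)}_n\ne0$). $S_n'$ is its derivative in $z$, $S_n^*(z;s):=z^nS_n(z^{-1};s)$, and $$H_n(z;s):=2\int_{\mathbb{T}}S_n(\zeta^{-1};s)w(\zeta)\zeta^{-s}\frac{1}{\zeta^2-z^2}\frac{d\zeta}{2\pi \mathrm{i}\zeta}.$$ *)

theory Defs
  imports
    "HOL-Complex_Analysis.Complex_Analysis"
    "HOL-Library.Landau_Symbols"
    "Jordan_Normal_Form.Determinant"
begin

no_notation Matrix.vec_index (infixl \<open>$\<close> 100)

definition unit_circle :: "complex set" where
  "unit_circle = sphere 0 1"

text \<open>Boundary values from the inside (\<open>fp\<close>) and from the outside (\<open>fm\<close>).  The limits are
  unrestricted limits taken within the respective open region.\<close>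

definition boundary_values ::
  "(complex \<Rightarrow> 'a::topological_space) \<Rightarrow> (complex \<Rightarrow> 'a) \<Rightarrow> (complex \<Rightarrow> 'a) \<Rightarrow> bool" where
  "boundary_values f fp fm \<longleftrightarrow>
     continuous_on unit_circle fp \<and> continuous_on unit_circle fm \<and>
     (\<forall>\<zeta>\<in>unit_circle.
        (f \<longlongrightarrow> fp \<zeta>) (at \<zeta> within ball 0 1) \<and>
        (f \<longlongrightarrow> fm \<zeta>) (at \<zeta> within - cball 0 1))"

definition cauchy_transform :: "(complex \<Rightarrow> complex) \<Rightarrow> complex \<Rightarrow> complex" where
  "cauchy_transform f z =
     contour_integral (circlepath 0 1) (\<lambda>\<zeta>. f \<zeta> / (\<zeta> - z)) / (2 * of_real pi * \<i>)"

text \<open>Every Laurent polynomial is \<open>\<zeta> powi k * poly p \<zeta>\<close> for some integer \<open>k\<close> and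
  polynomial \<open>p\<close>.\<close>

definition plemelj_regular :: "(complex \<Rightarrow> complex) \<Rightarrow> bool" where
  "plemelj_regular w \<longleftrightarrow>
     continuous_on unit_circle w \<and>
     (\<forall>(k::int) (p::complex poly).
        \<exists>fp fm.
          boundary_values (cauchy_transform (\<lambda>\<zeta>. w \<zeta> * (\<zeta> powi k * poly p \<zeta>))) fp fm \<and>
          (\<forall>\<zeta>\<in>unit_circle. fp \<zeta> - fm \<zeta> = w \<zeta> * (\<zeta> powi k * poly p \<zeta>)))"

text \<open>Integration over the unit circle against \<open>d\<zeta> / (2 \<pi> \<i> \<zeta>)\<close>.\<close>

definition circle_mean :: "(complex \<Rightarrow> complex) \<Rightarrow> complex" where
  "circle_mean f =
     contour_integral (circlepath 0 1) (\<lambda>\<zeta>. f \<zeta> / (2 * of_real pi * \<i> * \<zeta>))"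

definition moment :: "(complex \<Rightarrow> complex) \<Rightarrow> int \<Rightarrow> complex" where
  "moment w l = circle_mean (\<lambda>\<zeta>. w \<zeta> * \<zeta> powi (- l))"

definition E_det :: "(complex \<Rightarrow> complex) \<Rightarrow> int \<Rightarrow> nat \<Rightarrow> complex" where
  "E_det w t n =
     Determinant.det (Matrix.mat n n (\<lambda>(j, k). moment w (int j - 2 * int k + t)))"

definition Ehat_det :: "(complex \<Rightarrow> complex) \<Rightarrow> int \<Rightarrow> nat \<Rightarrow> complex" where
  "Ehat_det w s n =
     Determinant.det (Matrix.mat n n
       (\<lambda>(j, k). moment w ((if j = 0 then 0 else int j + 1) - 2 * int k + s)))"

definition g_coeff :: "(complex \<Rightarrow> complex) \<Rightarrow> int \<Rightarrow> nat \<Rightarrow> complex" where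
  "g_coeff w s n = E_det w s (n + 1) / E_det w s n"

definition is_S_poly :: "(complex \<Rightarrow> complex) \<Rightarrow> int \<Rightarrow> nat \<Rightarrow> complex poly \<Rightarrow> bool" where
  "is_S_poly w s n p \<longleftrightarrow>
     degree p = n \<and> lead_coeff p = 1 \<and>
     (\<forall>k<n. circle_mean (\<lambda>\<zeta>. poly p (inverse \<zeta>) * \<zeta> powi (2 * int k - s) * w \<zeta>) = 0)"

text \<open>Meaningful only when \<open>is_S_poly w s n\<close> has exactly one solution.\<close>

definition S_poly :: "(complex \<Rightarrow> complex) \<Rightarrow> int \<Rightarrow> nat \<Rightarrow> complex poly" where
  "S_poly w s n = (THE p. is_S_poly w s n p)"

text \<open>Since \<open>S_poly w s n\<close> has degree \<open>n\<close>, its reflected polynomial is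
  \<open>z ^ n * poly (S_poly w s n) (inverse z)\<close>, including its removable singularity at \<open>0\<close>.\<close>

definition S_star :: "(complex \<Rightarrow> complex) \<Rightarrow> int \<Rightarrow> nat \<Rightarrow> complex poly" where
  "S_star w s n = reflect_poly (S_poly w s n)"

definition H_fun :: "(complex \<Rightarrow> complex) \<Rightarrow> int \<Rightarrow> nat \<Rightarrow> complex \<Rightarrow> complex" where
  "H_fun w s n z =
     2 * circle_mean
           (\<lambda>\<zeta>. poly (S_poly w s n) (inverse \<zeta>) * w \<zeta> * \<zeta> powi (- s) * (1 / (\<zeta>\<^sup>2 - z\<^sup>2)))"

text \<open>The quotient \<open>(p(z) - p(-z)) / (2 z)\<close>, whose singularity at \<open>0\<close> is removable with
  value \<open>p'(0)\<close>.\<close>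

definition sym_quotient :: "complex poly \<Rightarrow> complex \<Rightarrow> complex" where
  "sym_quotient p z =
     (if z = 0 then poly (pderiv p) 0 else (poly p z - poly p (- z)) / (2 * z))"

definition B_matrix :: "(complex \<Rightarrow> complex) \<Rightarrow> nat \<Rightarrow> int \<Rightarrow> complex^3^3" where
  "B_matrix w m s = vector
     [vector [poly (S_poly w s (2*m)) 0, poly (pderiv (S_poly w s (2*m))) 0, 0],
      vector [poly (S_poly w s (2*m - 1)) 0, poly (pderiv (S_poly w s (2*m - 1))) 0, 0],
      vector [poly (S_poly w s (2*m - 2)) 0, poly (pderiv (S_poly w s (2*m - 2))) 0,
              - 2 * g_coeff w s (2*m - 2)]]"

definition S_H_matrix :: "(complex \<Rightarrow> complex) \<Rightarrow> nat \<Rightarrow> int \<Rightarrow> complex \<Rightarrow> complex^3^3" where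
  "S_H_matrix w m s z = vector
     [vector [poly (S_star w s (2*m)) z,
              sym_quotient (S_star w s (2*m)) z,
              H_fun w s (2*m) z],
      vector [z * poly (S_star w s (2*m - 1)) z,
              (poly (S_star w s (2*m - 1)) z + poly (S_star w s (2*m - 1)) (- z)) / 2,
              H_fun w s (2*m - 1) z],
      vector [z\<^sup>2 * poly (S_star w s (2*m - 2)) z,
              z / 2 * (poly (S_star w s (2*m - 2)) z - poly (S_star w s (2*m - 2)) (- z)),
              H_fun w s (2*m - 2) z]]"

definition k1 :: "(complex \<Rightarrow> complex) \<Rightarrow> nat \<Rightarrow> int \<Rightarrow> complex \<Rightarrow> complex" where
  "k1 w m s z = z powi (- 2 * int m - s - 2) * (w z + (- 1) powi s * w (- z))"

definition k2 :: "(complex \<Rightarrow> complex) \<Rightarrow> nat \<Rightarrow> int \<Rightarrow> complex \<Rightarrow> complex" where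
  "k2 w m s z = 2 * (- 1) powi (s + 1) * z powi (- 2 * int m - s - 1) * w (- z)"

definition jump_matrix :: "(complex \<Rightarrow> complex) \<Rightarrow> nat \<Rightarrow> int \<Rightarrow> complex \<Rightarrow> complex^3^3" where
  "jump_matrix w m s z =
     vector [vector [1, 0, k1 w m s z], vector [0, 1, k2 w m s z], vector [0, 0, 1]]"

definition diag3 :: "complex \<Rightarrow> complex \<Rightarrow> complex \<Rightarrow> complex^3^3" where
  "diag3 a b c = vector [vector [a, 0, 0], vector [0, b, 0], vector [0, 0, c]]"

definition of_columns :: "complex^3 \<Rightarrow> complex^3 \<Rightarrow> complex^3 \<Rightarrow> complex^3^3" where
  "of_columns a b c = transpose (vector [a, b, c])"

definition e3 :: "complex^3" where
  "e3 = vector [0, 0, 1]"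

definition X1_inf :: "complex^3^3" where
  "X1_inf = vector [vector [0, 0, 0], vector [1, 0, 0], vector [0, 0, 0]]"

text \<open>The coefficient of \<open>z ^ j\<close> in the expansion at \<open>0\<close> of the first column.\<close>

definition first_column_coeff :: "(complex \<Rightarrow> complex^3^3) \<Rightarrow> nat \<Rightarrow> complex^3" where
  "first_column_coeff X j = (\<chi> i. (deriv ^^ j) (\<lambda>z. X z $ i $ 1) 0 / fact j)"

definition rhp_analytic :: "(complex \<Rightarrow> complex^3^3) \<Rightarrow> bool" where
  "rhp_analytic X \<longleftrightarrow> (\<forall>i j. (\<lambda>z. X z $ i $ j) holomorphic_on - unit_circle)"

definition rhp_jump ::
  "(complex \<Rightarrow> complex) \<Rightarrow> nat \<Rightarrow> int \<Rightarrow> (complex \<Rightarrow> complex^3^3) \<Rightarrow> bool" where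
  "rhp_jump w m s X \<longleftrightarrow>
     (\<exists>Xp Xm. boundary_values X Xp Xm \<and>
        (\<forall>z\<in>unit_circle. Xp z = Xm z ** jump_matrix w m s z))"

definition rhp_infinity :: "nat \<Rightarrow> (complex \<Rightarrow> complex^3^3) \<Rightarrow> bool" where
  "rhp_infinity m X \<longleftrightarrow>
     (\<exists>(X2 :: complex^3^3) (R :: complex \<Rightarrow> complex^3^3).
        (\<forall>i j. (\<lambda>z. R z $ i $ j) \<in> O[at_infinity](\<lambda>z. z powi (- 3))) \<and>
        (\<forall>\<^sub>F z in at_infinity.
           X z = (\<chi> i j. (if i = j then 1 else 0) + X1_inf $ i $ j / z + X2 $ i $ j / z\<^sup>2
                          + R z $ i $ j)
                 ** diag3 (z powi (2 * int m)) (z powi (2 * int m - 2))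
                          (z powi (- 4 * int m + 2))))"

definition rhp_third_column :: "nat \<Rightarrow> (complex \<Rightarrow> complex^3^3) \<Rightarrow> complex^3 \<Rightarrow> bool" where
  "rhp_third_column m X \<phi> \<longleftrightarrow>
     (\<exists>r :: complex \<Rightarrow> complex^3.
        (\<forall>i. (\<lambda>z. r z $ i) \<in> O[at_infinity](\<lambda>z. z powi (- 4))) \<and>
        (\<forall>\<^sub>F z in at_infinity.
           column 3 (X z) = z powi (- 4 * int m + 2) *s (e3 + z powi (- 2) *s \<phi> + r z)))"

definition rhp_rank :: "(complex \<Rightarrow> complex^3^3) \<Rightarrow> complex^3 \<Rightarrow> bool" where
  "rhp_rank X \<phi> \<longleftrightarrow>
     (let v = first_column_coeff X in
        rank (of_columns (v 0) e3 \<phi>) = 3 \<and>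
        rank (of_columns (v 0) (v 1) e3) = 3 \<and>
        rank (of_columns (v 0) (v 1) (v 2)) = 3)"

definition solves_rhp ::
  "(complex \<Rightarrow> complex) \<Rightarrow> nat \<Rightarrow> int \<Rightarrow> (complex \<Rightarrow> complex^3^3) \<Rightarrow> bool" where
  "solves_rhp w m s X \<longleftrightarrow>
     rhp_analytic X \<and> rhp_jump w m s X \<and> rhp_infinity m X \<and>
     (\<exists>\<phi>. rhp_third_column m X \<phi> \<and> rhp_rank X \<phi>)"

end

theory Submission
  imports Defs
begin

text \<open>
  The first two columns of the jump matrix are trivial, and its third column is designed so that every
  polynomial \<open>p\<close> of degree at most \<open>2 m\<close> produces a row with the same jump as the solution \<open>X\<close>: the entries are
  \<open>p\<close>, its odd part divided by \<open>z\<close>, and the Cauchy transform of \<open>w \<zeta>\<^sup>-\<^sup>2\<^sup>m\<^sup>-\<^sup>s p\<close> with the even kernel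
  \<open>2 / (\<zeta>\<^sup>2 - z\<^sup>2)\<close> (\<open>rhp_row_jump\<close>, where the Plemelj formula enters).  The first two entries have the growth at
  infinity that the problem prescribes, and the third decays as prescribed as soon as the first \<open>2 m - 2\<close>
  even moments of \<open>w \<zeta>\<^sup>-\<^sup>2\<^sup>m\<^sup>-\<^sup>s p\<close> vanish.

  A row with this jump and growth is a constant combination of the rows of \<open>X\<close>
  (\<open>row_solution_unique\<close>): by Cramer's rule the coefficients are determinants that are continuous
  across the circle and converge at infinity, hence are constant by Liouville's theorem
  (\<open>liouville_across_circle\<close>), and they can be read off from the normalised row at infinity.
  So the row equals \<open>L v* X\<close>, where \<open>L\<close> consists of the coefficients of \<open>z\<^sup>2\<^sup>m\<close> and \<open>z\<^sup>2\<^sup>m\<^sup>-\<^sup>1\<close> in \<open>p\<close>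
  and of \<open>- 2\<close> times the moment of index \<open>2 m - 2\<close>
  (\<open>rhp_row_eq_combination\<close>).  Everything follows from this identity.

  For the determinants, a kernel vector of the matrix of \<open>E\<^sub>n\<close> amounts to such a polynomial \<open>p\<close>, with additional zeros
  at the origin or additional vanishing moments.  These make \<open>L\<close> orthogonal to three vectors which are independent by
  one of the rank conditions; therefore \<open>L = 0\<close> and \<open>p = 0\<close> (\<open>rhp_E_det_nonzero\<close>).

  For \<open>p = z\<^sup>2\<^sup>m S\<^sub>n(1/z)\<close> the vector \<open>L\<close> is a row of \<open>B\<close> and the row of \<open>p\<close> is a row of the matrix on
  the left of the asserted identity (\<open>rhp_S_row\<close>).  A vector annihilated by \<open>B\<close> therefore gives a linear
  relation between \<open>S*\<^sub>2\<^sub>m\<close>, \<open>z S*\<^sub>2\<^sub>m\<^sub>-\<^sub>1\<close> and \<open>z\<^sup>2 S*\<^sub>2\<^sub>m\<^sub>-\<^sub>2\<close>, which are independent because their lowest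
  terms are \<open>1\<close>, \<open>z\<close> and \<open>z\<^sup>2\<close>; so \<open>B\<close> is invertible.  Finally \<open>S\<^sub>n(0)\<close> and \<open>S\<^sub>n'(0)\<close> are
  cofactors of the moment matrix bordered by one row and one column, divided by \<open>E\<^sub>n\<close>, and \<open>det B\<close> becomes \<open>- 2 g\<^sub>2\<^sub>m\<^sub>-\<^sub>2\<close> times the quotient in the
  statement (\<open>det_B_matrix\<close>).
\<close>

section \<open>Means over the unit circle\<close>

lemma circle_mean_eq_integral:
  "circle_mean f = integral {0..1} (\<lambda>x. f (circlepath 0 1 x))"
proof -
  have "f (circlepath 0 1 x) / (2 * of_real pi * \<i> * circlepath 0 1 x)
          * vector_derivative (circlepath 0 1) (at x) = f (circlepath 0 1 x)" for x
    unfolding vector_derivative_circlepath by (simp add: circlepath)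
  then show ?thesis
    by (simp add: circle_mean_def contour_integral_integral)
qed

lemma circlepath_in_unit_circle: "circlepath 0 1 x \<in> unit_circle"
  by (simp add: unit_circle_def circlepath)

lemma continuous_on_compose_circlepath:
  assumes "continuous_on unit_circle f"
  shows "continuous_on {0..1} (\<lambda>x. f (circlepath 0 1 x))"
proof -
  have "continuous_on {0..1} (circlepath 0 1)"
    unfolding circlepath by (intro continuous_intros)
  then show ?thesis
    by (rule continuous_on_compose2[OF assms]) (auto simp: circlepath_in_unit_circle)
qed

lemma circle_mean_cong:
  assumes "\<And>\<zeta>. \<zeta> \<in> unit_circle \<Longrightarrow> f \<zeta> = g \<zeta>"
  shows "circle_mean f = circle_mean g"
  by (simp add: circle_mean_eq_integral assms circlepath_in_unit_circle)

lemma circle_mean_sum: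
  assumes "\<And>i. i \<in> I \<Longrightarrow> continuous_on unit_circle (f i)"
  shows "circle_mean (\<lambda>\<zeta>. \<Sum>i\<in>I. f i \<zeta>) = (\<Sum>i\<in>I. circle_mean (f i))"
proof (cases "finite I")
  case True
  then show ?thesis
    unfolding circle_mean_eq_integral
    by (intro integral_sum integrable_continuous_real continuous_on_compose_circlepath assms)
qed (simp add: circle_mean_eq_integral)

lemma circle_mean_diff:
  assumes "continuous_on unit_circle f" "continuous_on unit_circle g"
  shows "circle_mean (\<lambda>\<zeta>. f \<zeta> - g \<zeta>) = circle_mean f - circle_mean g"
  unfolding circle_mean_eq_integral
  by (intro integral_diff integrable_continuous_real continuous_on_compose_circlepath assms)

lemma circle_mean_cmult: "circle_mean (\<lambda>\<zeta>. c * f \<zeta>) = c * circle_mean f"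
  by (simp add: circle_mean_eq_integral)

lemma circle_mean_inverse:
  assumes "continuous_on unit_circle f"
  shows "circle_mean (\<lambda>\<zeta>. f (inverse \<zeta>)) = circle_mean f"
proof -
  let ?h = "\<lambda>x. f (circlepath 0 1 x)"
  have refl: "inverse (circlepath 0 1 x) = circlepath 0 1 (1 - x)" for x
    by (simp add: circlepath exp_minus [symmetric] right_diff_distrib exp_diff divide_inverse)
  have "(?h has_integral circle_mean f) {0..1}"
    unfolding circle_mean_eq_integral
    by (intro integrable_integral integrable_continuous_real
        continuous_on_compose_circlepath assms)
  from has_integral_affinity01[OF this, of "-1" 1]
  have "((\<lambda>x. ?h (1 - x)) has_integral circle_mean f) {0..1}"
    by simp
  then show ?thesis
    by (simp add: circle_mean_eq_integral refl integral_unique)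
qed

text \<open>Cauchy's integral formula for a function that is merely continuous up to the circle, written for
the normalised measure \<open>d\<zeta> / (2 \<pi> \<i> \<zeta>)\<close>; this is the source of the extra factor \<open>\<zeta>\<close>.\<close>

lemma circle_mean_Cauchy:
  assumes "continuous_on (cball 0 1) h" "h holomorphic_on ball 0 1" "norm z < 1"
  shows "circle_mean (\<lambda>\<zeta>. \<zeta> * h \<zeta> / (\<zeta> - z)) = h z"
proof -
  have "contour_integral (circlepath 0 1) (\<lambda>\<zeta>. \<zeta> * h \<zeta> / (\<zeta> - z) / (2 * of_real pi * \<i> * \<zeta>))
      = contour_integral (circlepath 0 1) (\<lambda>\<zeta>. inverse (2 * of_real pi * \<i>) * (h \<zeta> / (\<zeta> - z)))"
  proof (rule contour_integral_eq)
    fix \<zeta> assume "\<zeta> \<in> path_image (circlepath 0 1)"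
    then have "\<zeta> \<noteq> 0" "\<zeta> - z \<noteq> 0"
      using assms(3) by auto
    then show "\<zeta> * h \<zeta> / (\<zeta> - z) / (2 * of_real pi * \<i> * \<zeta>)
        = inverse (2 * of_real pi * \<i>) * (h \<zeta> / (\<zeta> - z))"
      by (simp add: divide_simps)
  qed
  also have "\<dots> = inverse (2 * of_real pi * \<i>) * (2 * of_real pi * \<i> * h z)"
    by (intro contour_integral_unique has_contour_integral_lmul Cauchy_integral_circlepath)
      (use assms in auto)
  also have "\<dots> = h z"
    by (subst mult.assoc [symmetric], subst left_inverse) auto
  finally show ?thesis
    by (simp add: circle_mean_def)
qed

section \<open>Liouville's theorem across the unit circle\<close>

lemma continuous_on_disc_with_boundary:
  fixes G :: "complex \<Rightarrow> complex"
  assumes G: "continuous_on (ball 0 1) G" and g: "continuous_on unit_circle g"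
    and lim: "\<And>\<zeta>. \<zeta> \<in> unit_circle \<Longrightarrow> (G \<longlongrightarrow> g \<zeta>) (at \<zeta> within ball 0 1)"
  shows "continuous_on (cball 0 1) (\<lambda>z. if z \<in> ball 0 1 then G z else g z)"
    (is "continuous_on _ ?h")
  unfolding continuous_on_def
proof
  fix z :: complex assume z: "z \<in> cball 0 1"
  have un: "cball 0 1 = ball 0 1 \<union> (unit_circle :: complex set)"
    unfolding unit_circle_def by auto
  show "(?h \<longlongrightarrow> ?h z) (at z within cball 0 1)"
  proof (cases "z \<in> ball 0 1")
    case True
    then have "continuous_on (ball 0 1) ?h \<longleftrightarrow> continuous_on (ball 0 1) G"
      by (intro continuous_on_cong) auto
    with G True have "isCont ?h z"
      by (metis continuous_on_eq_continuous_at open_ball)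
    then show ?thesis
      by (simp add: isCont_def tendsto_within_subset[where S=UNIV])
  next
    case False
    with z have zc: "z \<in> unit_circle"
      by (auto simp: unit_circle_def)
    have 1: "(?h \<longlongrightarrow> g z) (at z within ball 0 1)"
      by (rule Lim_transform_eventually[OF lim[OF zc]])
        (simp add: eventually_at_filter)
    have "(g \<longlongrightarrow> g z) (at z within unit_circle)"
      using g zc by (auto simp: continuous_on_def)
    then have 2: "(?h \<longlongrightarrow> g z) (at z within unit_circle)"
      by (rule Lim_transform_eventually) (simp add: eventually_at_filter unit_circle_def)
    show ?thesis
      using 1 2 False unfolding un by (auto simp: Lim_within_Un)
  qed
qed

lemma at_within_ball_nontrivial:
  "\<zeta> \<in> unit_circle \<Longrightarrow> at \<zeta> within ball 0 1 \<noteq> bot"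
  using islimpt_ball[of \<zeta> 0 1] by (auto simp: trivial_limit_within unit_circle_def)

lemma removable_singularity_value:
  fixes h :: "complex \<Rightarrow> complex"
  assumes "open S" "h holomorphic_on S - {a}" "(h \<longlongrightarrow> h a) (at a)"
  shows "h holomorphic_on S"
  by (rule no_isolated_singularity'[of "{a}"])
    (use assms in \<open>auto intro: tendsto_within_subset[where S=UNIV]\<close>)

text \<open>Inversion turns approach to \<open>\<zeta>\<close> from inside into approach to \<open>1 / \<zeta>\<close> from outside, so that boundary
values from the outside become boundary values of a function on the disc.\<close>

lemma inverse_maps_exterior:
  assumes "\<zeta> \<in> unit_circle"
  shows "filterlim inverse (at (inverse \<zeta>) within - cball 0 1) (at \<zeta> within ball 0 (1::real))"
proof -
  have [simp]: "\<zeta> \<noteq> 0" using assms by (auto simp: unit_circle_def)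
  have "((inverse :: complex \<Rightarrow> complex) \<longlongrightarrow> inverse \<zeta>) (at \<zeta> within ball 0 1)"
    by (intro tendsto_intros) auto
  moreover have "\<forall>\<^sub>F u in at \<zeta> within ball 0 1. u \<noteq> 0"
    by (rule tendsto_imp_eventually_ne[where c=\<zeta>]) (auto intro: tendsto_eq_intros)
  then have "\<forall>\<^sub>F u in at \<zeta> within ball 0 1. inverse u \<in> - cball 0 1 \<and> inverse u \<noteq> inverse \<zeta>"
  proof (rule eventually_rev_mp[OF _ eventually_at_filter[THEN iffD2]])
    show "\<forall>\<^sub>F u in nhds \<zeta>. u \<noteq> \<zeta> \<longrightarrow> u \<in> ball 0 1 \<longrightarrow> u \<noteq> 0 \<longrightarrow>
        inverse u \<in> - cball 0 1 \<and> inverse u \<noteq> inverse \<zeta>"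
      by (intro always_eventually) (auto simp: norm_inverse inverse_le_1_iff)
  qed
  ultimately show ?thesis
    by (auto simp: filterlim_at elim: eventually_mono)
qed

text \<open>Liouville's theorem for a function whose boundary values from the two sides agree.  With \<open>h u = F (1 / u)\<close>, which
extends to \<open>0\<close> with value \<open>c\<close>, the Cauchy integral for \<open>F z\<close> inside the disc becomes, after the substitution
\<open>\<zeta> \<mapsto> 1 / \<zeta>\<close>, the mean of \<open>h \<zeta> / (1 - z \<zeta>)\<close>.  That function is holomorphic in the disc, so its mean is its
value at \<open>0\<close>, namely \<open>c\<close>, whatever \<open>z\<close> is.  Then the boundary values are \<open>c\<close> as well, and Cauchy's formula
for \<open>h\<close> gives the exterior.\<close>

proposition liouville_across_circle:
  assumes hol: "F holomorphic_on - unit_circle"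
    and bv: "boundary_values F f f"
    and inf: "(F \<longlongrightarrow> c) at_infinity"
    and z: "z \<notin> unit_circle"
  shows "F z = c"
proof -
  have f: "continuous_on unit_circle f"
    and lim_in: "\<And>\<zeta>. \<zeta> \<in> unit_circle \<Longrightarrow> (F \<longlongrightarrow> f \<zeta>) (at \<zeta> within ball 0 1)"
    and lim_out: "\<And>\<zeta>. \<zeta> \<in> unit_circle \<Longrightarrow> (F \<longlongrightarrow> f \<zeta>) (at \<zeta> within - cball 0 1)"
    using bv by (auto simp: boundary_values_def)
  have holi: "F holomorphic_on ball 0 1"
    using hol by (rule holomorphic_on_subset) (auto simp: unit_circle_def)
  define Fi where "Fi = (\<lambda>z. if z \<in> ball 0 1 then F z else f z)"
  have Fi_cont: "continuous_on (cball 0 1) Fi"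
    unfolding Fi_def
    by (intro continuous_on_disc_with_boundary f lim_in holomorphic_on_imp_continuous_on holi)
  have Fi_hol: "Fi holomorphic_on ball 0 1"
    by (rule holomorphic_transform[OF holi]) (simp add: Fi_def)
  define g where "g = (\<lambda>u. if u = 0 then c else F (inverse u))"
  define h where "h = (\<lambda>u. if u \<in> ball 0 1 then g u else f (inverse u))"
  have g_hol: "g holomorphic_on ball 0 1"
  proof (rule removable_singularity_value[where a=0])
    have "(\<lambda>u. F (inverse u)) holomorphic_on ball 0 1 - {0}"
      by (rule holomorphic_on_compose[OF _ holomorphic_on_subset[OF hol], unfolded o_def])
        (auto intro!: holomorphic_intros simp: unit_circle_def norm_inverse)
    then show "g holomorphic_on ball 0 1 - {0}"
      by (rule holomorphic_transform) (simp add: g_def)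
    have "((\<lambda>u. F (inverse u)) \<longlongrightarrow> c) (at 0)"
      using inf by (simp add: lim_at_infinity_0 o_def)
    then have "(g \<longlongrightarrow> c) (at 0)"
      by (rule Lim_transform_eventually) (simp add: g_def eventually_at_filter)
    then show "(g \<longlongrightarrow> g 0) (at 0)"
      by (simp add: g_def)
  qed auto
  have inv_circle: "inverse \<zeta> \<in> unit_circle" if "\<zeta> \<in> unit_circle" for \<zeta>
    using that by (simp add: unit_circle_def norm_inverse)
  have f_inv: "continuous_on unit_circle (\<lambda>\<zeta>. f (inverse \<zeta>))"
    by (rule continuous_on_compose2[OF f])
      (auto intro!: continuous_intros simp: unit_circle_def norm_inverse)
  have h_cont: "continuous_on (cball 0 1) h"
    unfolding h_def
  proof (intro continuous_on_disc_with_boundary f_inv holomorphic_on_imp_continuous_on g_hol)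
    fix \<zeta> assume \<zeta>: "\<zeta> \<in> unit_circle"
    have "((\<lambda>u. F (inverse u)) \<longlongrightarrow> f (inverse \<zeta>)) (at \<zeta> within ball 0 1)"
      by (rule filterlim_compose[OF lim_out[OF inv_circle[OF \<zeta>]] inverse_maps_exterior[OF \<zeta>]])
    moreover have "\<forall>\<^sub>F u in at \<zeta> within ball 0 1. u \<noteq> 0"
      by (rule tendsto_imp_eventually_ne[where c=\<zeta>]) (use \<zeta> in \<open>auto simp: unit_circle_def\<close>)
    then have "\<forall>\<^sub>F u in at \<zeta> within ball 0 1. F (inverse u) = g u"
      by eventually_elim (simp add: g_def)
    ultimately show "(g \<longlongrightarrow> f (inverse \<zeta>)) (at \<zeta> within ball 0 1)"
      by (rule Lim_transform_eventually)
  qed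
  have h_hol: "h holomorphic_on ball 0 1"
    by (rule holomorphic_transform[OF g_hol]) (simp add: h_def)
  have inside: "F z = c" if z: "norm z < 1" for z
  proof -
    have nz: "1 - z * \<zeta> \<noteq> 0" if "\<zeta> \<in> cball 0 1" for \<zeta>
    proof
      assume "1 - z * \<zeta> = 0"
      then have "norm z * norm \<zeta> = 1"
        by (metis eq_iff_diff_eq_0 norm_mult norm_one)
      with z that show False
        by (metis dist_0_norm linorder_not_le mem_cball mult_left_le norm_ge_zero)
    qed
    have "F z = circle_mean (\<lambda>\<zeta>. \<zeta> * Fi \<zeta> / (\<zeta> - z))"
      using circle_mean_Cauchy[OF Fi_cont Fi_hol z] z by (simp add: Fi_def)
    also have "\<dots> = circle_mean (\<lambda>\<zeta>. inverse \<zeta> * Fi (inverse \<zeta>) / (inverse \<zeta> - z))"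
      by (rule circle_mean_inverse[symmetric])
        (use z in \<open>auto intro!: continuous_intros continuous_on_subset[OF Fi_cont]
           simp: unit_circle_def\<close>)
    also have "\<dots> = circle_mean (\<lambda>\<zeta>. \<zeta> * (h \<zeta> / (1 - z * \<zeta>)) / (\<zeta> - 0))"
    proof (rule circle_mean_cong)
      fix \<zeta> assume \<zeta>: "\<zeta> \<in> unit_circle"
      then have "\<zeta> \<noteq> 0" "Fi (inverse \<zeta>) = h \<zeta>"
        by (auto simp: unit_circle_def Fi_def h_def norm_inverse)
      then show "inverse \<zeta> * Fi (inverse \<zeta>) / (inverse \<zeta> - z) = \<zeta> * (h \<zeta> / (1 - z * \<zeta>)) / (\<zeta> - 0)"
        using nz[of \<zeta>] \<zeta> by (auto simp: unit_circle_def field_simps)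
    qed
    also have "\<dots> = h 0 / (1 - z * 0)"
      by (rule circle_mean_Cauchy)
        (use nz in \<open>auto intro!: continuous_intros h_cont holomorphic_intros h_hol\<close>)
    finally show ?thesis
      by (simp add: h_def g_def)
  qed
  have f_const: "f \<zeta> = c" if "\<zeta> \<in> unit_circle" for \<zeta>
  proof (rule tendsto_unique[OF at_within_ball_nontrivial lim_in])
    show "(F \<longlongrightarrow> c) (at \<zeta> within ball 0 1)"
      by (rule tendsto_eventually) (auto simp: eventually_at_filter inside)
  qed (use that in auto)
  show ?thesis
  proof (cases "norm z < 1")
    case False
    with z have nz: "norm z > 1"
      by (auto simp: unit_circle_def)
    then have u: "norm (inverse z) < 1"
      by (auto simp: norm_inverse inverse_less_1_iff)
    have "F z = h (inverse z)"
      using u nz by (auto simp: h_def g_def)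
    also have "\<dots> = circle_mean (\<lambda>\<zeta>. \<zeta> * h \<zeta> / (\<zeta> - inverse z))"
      by (rule circle_mean_Cauchy[OF h_cont h_hol u, symmetric])
    also have "\<dots> = circle_mean (\<lambda>\<zeta>. \<zeta> * (\<lambda>_. c) \<zeta> / (\<zeta> - inverse z))"
      by (rule circle_mean_cong) (auto simp: h_def f_const inv_circle, auto simp: unit_circle_def norm_inverse)
    also have "\<dots> = c"
      by (rule circle_mean_Cauchy) (use u in auto)
    finally show ?thesis .
  qed (use inside in auto)
qed

section \<open>The Cauchy transform\<close>

lemma not_in_unit_circle_at_infinity: "\<forall>\<^sub>F z in at_infinity. z \<notin> unit_circle"
  unfolding eventually_at_infinity unit_circle_def by (intro exI[of _ 2]) auto

lemma uminus_in_unit_circle_iff [simp]: "- \<zeta> \<in> unit_circle \<longleftrightarrow> \<zeta> \<in> unit_circle"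
  by (simp add: unit_circle_def)

lemma cauchy_transform_cong:
  assumes "\<And>\<zeta>. \<zeta> \<in> unit_circle \<Longrightarrow> f \<zeta> = g \<zeta>"
  shows "cauchy_transform f = cauchy_transform g"
proof
  fix z
  have "contour_integral (circlepath 0 1) (\<lambda>\<zeta>. f \<zeta> / (\<zeta> - z))
      = contour_integral (circlepath 0 1) (\<lambda>\<zeta>. g \<zeta> / (\<zeta> - z))"
    by (rule contour_integral_eq) (simp add: assms unit_circle_def)
  then show "cauchy_transform f z = cauchy_transform g z"
    by (simp add: cauchy_transform_def)
qed

lemma cauchy_integrable:
  assumes "continuous_on unit_circle g" "z \<notin> unit_circle"
  shows "(\<lambda>\<zeta>. g \<zeta> / (\<zeta> - z)) contour_integrable_on circlepath 0 1"
  using assms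
  by (intro contour_integrable_continuous_circlepath continuous_intros)
    (auto simp: unit_circle_def)

lemma cauchy_transform_holomorphic:
  assumes g: "continuous_on unit_circle g"
  shows "cauchy_transform g holomorphic_on - unit_circle"
proof -
  define c where "c = (\<lambda>z. contour_integral (circlepath 0 1) (\<lambda>\<zeta>. g \<zeta> / (\<zeta> - z)))"
  have "c field_differentiable at z within - unit_circle" if z: "z \<notin> unit_circle" for z
  proof -
    have "(c has_field_derivative of_nat 1 *
        contour_integral (circlepath 0 1) (\<lambda>\<zeta>. g \<zeta> / (\<zeta> - z) ^ Suc 1)) (at z)"
    proof (rule Cauchy_next_derivative(2)[where S=UNIV and B="2 * pi"])
      show "continuous_on (path_image (circlepath 0 1)) g"
        using g by (simp add: unit_circle_def)
      show "norm (vector_derivative (circlepath 0 1) (at t)) \<le> 2 * pi" for t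
        unfolding vector_derivative_circlepath by (simp add: norm_mult)
      show "((\<lambda>\<zeta>. g \<zeta> / (\<zeta> - u) ^ 1) has_contour_integral c u) (circlepath 0 1)"
        if "u \<in> UNIV - path_image (circlepath 0 1)" for u
        using has_contour_integral_integral[OF cauchy_integrable[OF g, of u]] that
        by (simp add: c_def unit_circle_def)
    qed (use z in \<open>auto simp: unit_circle_def\<close>)
    then show ?thesis
      using field_differentiable_at_within field_differentiable_def by blast
  qed
  then have "(\<lambda>z. c z / (2 * of_real pi * \<i>)) holomorphic_on - unit_circle"
    by (intro holomorphic_intros) (auto simp: holomorphic_on_def)
  then show ?thesis
    by (simp add: c_def cauchy_transform_def [abs_def])
qed

lemma cauchy_transform_at_infinity:
  assumes g: "continuous_on unit_circle g"
  shows "(cauchy_transform g \<longlongrightarrow> 0) at_infinity"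
proof -
  have "compact (g ` unit_circle)"
    by (intro compact_continuous_image g) (auto simp: unit_circle_def)
  then obtain B where B: "\<And>\<zeta>. \<zeta> \<in> unit_circle \<Longrightarrow> norm (g \<zeta>) \<le> B" and "B > 0"
    by (metis bounded_pos compact_imp_bounded imageI)
  have bound: "norm (cauchy_transform g z) \<le> 2 * B * norm (inverse z)" if z: "2 \<le> norm z" for z
  proof -
    have "norm (contour_integral (circlepath 0 1) (\<lambda>\<zeta>. g \<zeta> / (\<zeta> - z)))
        \<le> (2 * B * norm (inverse z)) * (2 * pi * 1)"
    proof (rule has_contour_integral_bound_circlepath)
      show "((\<lambda>\<zeta>. g \<zeta> / (\<zeta> - z)) has_contour_integral
          contour_integral (circlepath 0 1) (\<lambda>\<zeta>. g \<zeta> / (\<zeta> - z))) (circlepath 0 1)"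
        by (intro has_contour_integral_integral cauchy_integrable g)
          (use z in \<open>auto simp: unit_circle_def\<close>)
    next
      fix \<zeta> :: complex assume \<zeta>: "norm (\<zeta> - 0) = 1"
      have "norm z - norm \<zeta> \<le> norm (\<zeta> - z)"
        by (metis norm_minus_commute norm_triangle_ineq2)
      with z \<zeta> have d: "norm z / 2 \<le> norm (\<zeta> - z)"
        by simp
      have "norm (g \<zeta> / (\<zeta> - z)) \<le> B / (norm z / 2)"
        unfolding norm_divide
        by (intro frac_le B d) (use \<zeta> z \<open>B > 0\<close> in \<open>auto simp: unit_circle_def\<close>)
      then show "norm (g \<zeta> / (\<zeta> - z)) \<le> 2 * B * norm (inverse z)"
        by (simp add: inverse_eq_divide norm_divide mult.commute)
    qed (use \<open>B > 0\<close> in auto)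
    then have "norm (contour_integral (circlepath 0 1) (\<lambda>\<zeta>. g \<zeta> / (\<zeta> - z))) / (2 * pi)
        \<le> 2 * B * norm (inverse z)"
      by (subst pos_divide_le_eq) auto
    then show ?thesis
      by (simp add: cauchy_transform_def norm_divide norm_mult)
  qed
  show ?thesis
  proof (rule Lim_null_comparison)
    show "\<forall>\<^sub>F z in at_infinity. norm (cauchy_transform g z) \<le> 2 * B * norm (inverse z)"
      unfolding eventually_at_infinity using bound by blast
    show "((\<lambda>z::complex. 2 * B * norm (inverse z)) \<longlongrightarrow> 0) at_infinity"
      using tendsto_mult_right_zero[OF tendsto_norm_zero[OF tendsto_inverse_0]] by blast
  qed
qed

section \<open>The Cauchy transform with even kernel\<close>

text \<open>Twice the mean of \<open>g\<close> against \<open>1 / (\<zeta>\<^sup>2 - z\<^sup>2)\<close>.  The functions \<open>H_fun\<close> have this shape.  By partial fractions it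
is \<open>C z + C (- z)\<close> for a Cauchy transform \<open>C\<close>, from which it inherits holomorphy and boundary values.\<close>

definition square_transform :: "(complex \<Rightarrow> complex) \<Rightarrow> complex \<Rightarrow> complex" where
  "square_transform g z = 2 * circle_mean (\<lambda>\<zeta>. g \<zeta> / (\<zeta>\<^sup>2 - z\<^sup>2))"

lemma square_diff_nonzero:
  fixes \<zeta> z :: complex
  assumes "\<zeta> \<in> unit_circle" "z \<notin> unit_circle"
  shows "\<zeta>\<^sup>2 - z\<^sup>2 \<noteq> 0"
  using assms by (auto simp: power2_eq_iff)

lemma square_transform_cong:
  assumes "\<And>\<zeta>. \<zeta> \<in> unit_circle \<Longrightarrow> f \<zeta> = g \<zeta>"
  shows "square_transform f = square_transform g"
  by (auto simp: square_transform_def fun_eq_iff assms intro!: circle_mean_cong)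

lemma square_transform_eq_cauchy:
  assumes g: "continuous_on unit_circle g" and z: "z \<notin> unit_circle"
  shows "square_transform g z
    = cauchy_transform (\<lambda>\<zeta>. g \<zeta> / \<zeta>\<^sup>2) z + cauchy_transform (\<lambda>\<zeta>. g \<zeta> / \<zeta>\<^sup>2) (- z)"
proof -
  let ?h = "\<lambda>\<zeta>. g \<zeta> / \<zeta>\<^sup>2"
  have h: "continuous_on unit_circle ?h"
    by (intro continuous_intros g) (auto simp: unit_circle_def)
  have "cauchy_transform ?h z + cauchy_transform ?h (- z)
      = contour_integral (circlepath 0 1) (\<lambda>\<zeta>. ?h \<zeta> / (\<zeta> - z) + ?h \<zeta> / (\<zeta> - (- z)))
        / (2 * of_real pi * \<i>)"
    unfolding cauchy_transform_def
    by (subst contour_integral_add[OF cauchy_integrable[OF h] cauchy_integrable[OF h]])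
      (use z in \<open>simp_all add: add_divide_distrib\<close>)
  also have "\<dots> = inverse (2 * of_real pi * \<i>) *
      contour_integral (circlepath 0 1) (\<lambda>\<zeta>. ?h \<zeta> / (\<zeta> - z) + ?h \<zeta> / (\<zeta> - (- z)))"
    by (rule divide_inverse_commute)
  also have "\<dots> = contour_integral (circlepath 0 1)
      (\<lambda>\<zeta>. inverse (2 * of_real pi * \<i>) * (?h \<zeta> / (\<zeta> - z) + ?h \<zeta> / (\<zeta> - (- z))))"
    by (intro contour_integral_lmul[symmetric] contour_integrable_add cauchy_integrable h)
      (use z in auto)
  also have "\<dots> = circle_mean (\<lambda>\<zeta>. 2 * (g \<zeta> / (\<zeta>\<^sup>2 - z\<^sup>2)))"
    unfolding circle_mean_def
  proof (rule contour_integral_eq)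
    fix \<zeta> assume "\<zeta> \<in> path_image (circlepath 0 1)"
    then have \<zeta>: "\<zeta> \<in> unit_circle" and [simp]: "\<zeta> \<noteq> 0"
      by (auto simp: unit_circle_def)
    then have nz: "\<zeta> - z \<noteq> 0" "\<zeta> - (- z) \<noteq> 0"
      using z by (auto simp: eq_neg_iff_add_eq_0[symmetric])
    have "1 / (\<zeta> - z) + 1 / (\<zeta> - (- z)) = 2 * \<zeta> / (\<zeta>\<^sup>2 - z\<^sup>2)"
      using nz square_diff_nonzero[OF \<zeta> z] by (simp add: divide_simps) (simp add: power2_eq_square algebra_simps)
    then have "?h \<zeta> / (\<zeta> - z) + ?h \<zeta> / (\<zeta> - (- z)) = ?h \<zeta> * (2 * \<zeta> / (\<zeta>\<^sup>2 - z\<^sup>2))"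
      by (metis (no_types, lifting) distrib_left mult.right_neutral times_divide_eq_right)
    also have "\<dots> = 2 * (g \<zeta> / (\<zeta>\<^sup>2 - z\<^sup>2)) / \<zeta>"
      by (simp add: power2_eq_square mult.commute)
    finally have kernels: "?h \<zeta> / (\<zeta> - z) + ?h \<zeta> / (\<zeta> - (- z))
        = 2 * (g \<zeta> / (\<zeta>\<^sup>2 - z\<^sup>2)) / \<zeta>" .
    have cancel: "inverse a * (b / c) = b / (a * c)" for a b c :: complex
      by (simp add: divide_inverse)
    show "inverse (2 * of_real pi * \<i>) * (?h \<zeta> / (\<zeta> - z) + ?h \<zeta> / (\<zeta> - (- z)))
        = 2 * (g \<zeta> / (\<zeta>\<^sup>2 - z\<^sup>2)) / (2 * of_real pi * \<i> * \<zeta>)"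
      unfolding kernels by (rule cancel)
  qed
  also have "\<dots> = square_transform g z"
    unfolding square_transform_def by (rule circle_mean_cmult)
  finally show ?thesis ..
qed

lemma continuous_on_divide_square:
  fixes g :: "complex \<Rightarrow> complex"
  assumes "continuous_on unit_circle g"
  shows "continuous_on unit_circle (\<lambda>\<zeta>. g \<zeta> / \<zeta>\<^sup>2)"
  by (intro continuous_intros assms) (auto simp: unit_circle_def)

lemma square_transform_holomorphic:
  assumes g: "continuous_on unit_circle g"
  shows "square_transform g holomorphic_on - unit_circle"
proof (rule holomorphic_transform)
  let ?C = "cauchy_transform (\<lambda>\<zeta>. g \<zeta> / \<zeta>\<^sup>2)"
  have C: "?C holomorphic_on - unit_circle"
    by (intro cauchy_transform_holomorphic continuous_on_divide_square g)
  have "(\<lambda>z. ?C (- z)) holomorphic_on - unit_circle"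
    by (rule holomorphic_on_compose[of uminus, OF _ holomorphic_on_subset[OF C], unfolded o_def])
      (auto intro!: holomorphic_intros)
  with C show "(\<lambda>z. ?C z + ?C (- z)) holomorphic_on - unit_circle"
    by (intro holomorphic_intros)
qed (use square_transform_eq_cauchy[OF g] in auto)

lemma square_transform_at_infinity:
  assumes g: "continuous_on unit_circle g"
  shows "(square_transform g \<longlongrightarrow> 0) at_infinity"
proof (rule Lim_transform_eventually)
  let ?C = "cauchy_transform (\<lambda>\<zeta>. g \<zeta> / \<zeta>\<^sup>2)"
  have C: "(?C \<longlongrightarrow> 0) at_infinity"
    by (intro cauchy_transform_at_infinity continuous_on_divide_square g)
  have "filterlim uminus at_infinity (at_infinity :: complex filter)"
    by (simp add: filterlim_at_infinity_conv_norm_at_top filterlim_norm_at_top)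
  from tendsto_add[OF C filterlim_compose[OF C this]]
  show "((\<lambda>z. ?C z + ?C (- z)) \<longlongrightarrow> 0) at_infinity"
    by simp
  show "\<forall>\<^sub>F z in at_infinity. ?C z + ?C (- z) = square_transform g z"
    using not_in_unit_circle_at_infinity
    by eventually_elim (simp add: square_transform_eq_cauchy[OF g])
qed

text \<open>Follows from \<open>z\<^sup>2 / (\<zeta>\<^sup>2 - z\<^sup>2) = \<zeta>\<^sup>2 / (\<zeta>\<^sup>2 - z\<^sup>2) - 1\<close>.  Each use peels off one term of the expansion at
infinity without any convergence argument, and only even powers of \<open>\<zeta>\<close> ever enter.\<close>

lemma square_transform_recursion:
  assumes g: "continuous_on unit_circle g" and z: "z \<notin> unit_circle"
  shows "z\<^sup>2 * square_transform g z
    = square_transform (\<lambda>\<zeta>. \<zeta>\<^sup>2 * g \<zeta>) z - 2 * circle_mean g"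
proof -
  have "z\<^sup>2 * circle_mean (\<lambda>\<zeta>. g \<zeta> / (\<zeta>\<^sup>2 - z\<^sup>2))
      = circle_mean (\<lambda>\<zeta>. z\<^sup>2 * (g \<zeta> / (\<zeta>\<^sup>2 - z\<^sup>2)))"
    by (rule circle_mean_cmult[symmetric])
  also have "\<dots> = circle_mean (\<lambda>\<zeta>. \<zeta>\<^sup>2 * g \<zeta> / (\<zeta>\<^sup>2 - z\<^sup>2) - g \<zeta>)"
  proof (rule circle_mean_cong)
    fix \<zeta> assume "\<zeta> \<in> unit_circle"
    then have "\<zeta>\<^sup>2 - z\<^sup>2 \<noteq> 0"
      by (rule square_diff_nonzero[OF _ z])
    then show "z\<^sup>2 * (g \<zeta> / (\<zeta>\<^sup>2 - z\<^sup>2)) = \<zeta>\<^sup>2 * g \<zeta> / (\<zeta>\<^sup>2 - z\<^sup>2) - g \<zeta>"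
      by (subst divide_diff_eq_iff) (auto simp: algebra_simps)
  qed
  also have "\<dots> = circle_mean (\<lambda>\<zeta>. \<zeta>\<^sup>2 * g \<zeta> / (\<zeta>\<^sup>2 - z\<^sup>2)) - circle_mean g"
    by (intro circle_mean_diff continuous_intros g)
      (use square_diff_nonzero[OF _ z] in auto)
  finally have "z\<^sup>2 * circle_mean (\<lambda>\<zeta>. g \<zeta> / (\<zeta>\<^sup>2 - z\<^sup>2))
      = circle_mean (\<lambda>\<zeta>. \<zeta>\<^sup>2 * g \<zeta> / (\<zeta>\<^sup>2 - z\<^sup>2)) - circle_mean g" .
  from arg_cong[OF this, of "\<lambda>x. 2 * x"] show ?thesis
    by (simp add: square_transform_def right_diff_distrib mult.left_commute)
qed

lemma square_transform_moments_vanish: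
  assumes g: "continuous_on unit_circle g" and z: "z \<notin> unit_circle"
    and "\<And>k. k < K \<Longrightarrow> circle_mean (\<lambda>\<zeta>. \<zeta> ^ (2 * k) * g \<zeta>) = 0"
  shows "z ^ (2 * K) * square_transform g z = square_transform (\<lambda>\<zeta>. \<zeta> ^ (2 * K) * g \<zeta>) z"
  using assms(3)
proof (induction K)
  case (Suc K)
  have "z ^ (2 * Suc K) * square_transform g z
      = z\<^sup>2 * square_transform (\<lambda>\<zeta>. \<zeta> ^ (2 * K) * g \<zeta>) z"
    using Suc by (simp add: power_add mult.assoc power2_eq_square)
  also have "\<dots> = square_transform (\<lambda>\<zeta>. \<zeta>\<^sup>2 * (\<zeta> ^ (2 * K) * g \<zeta>)) z"
    using Suc.prems[of K] by (subst square_transform_recursion) (auto intro!: continuous_intros g z)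
  finally show ?case
    by (simp add: power2_eq_square mult.assoc)
qed simp

text \<open>Vanishing even moments of \<open>g\<close> amount to decay of its transform at infinity, and the first moment that survives is
the leading coefficient.  This translates orthogonality into the growth conditions of the Riemann-Hilbert problem.\<close>

lemma square_transform_asymptotics:
  assumes g: "continuous_on unit_circle g"
    and van: "\<And>k. k < K \<Longrightarrow> circle_mean (\<lambda>\<zeta>. \<zeta> ^ (2 * k) * g \<zeta>) = 0"
  shows "((\<lambda>z. z ^ (2 * K + 2) * square_transform g z)
      \<longlongrightarrow> - 2 * circle_mean (\<lambda>\<zeta>. \<zeta> ^ (2 * K) * g \<zeta>)) at_infinity"
proof (rule Lim_transform_eventually)
  let ?h = "\<lambda>\<zeta>. \<zeta> ^ (2 * K) * g \<zeta>"
  have h: "continuous_on unit_circle ?h"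
    by (intro continuous_intros g)
  have "(square_transform (\<lambda>\<zeta>. \<zeta>\<^sup>2 * ?h \<zeta>) \<longlongrightarrow> 0) at_infinity"
    by (intro square_transform_at_infinity continuous_intros g)
  from tendsto_diff[OF this tendsto_const, of "2 * circle_mean ?h"]
  show "((\<lambda>z. square_transform (\<lambda>\<zeta>. \<zeta>\<^sup>2 * ?h \<zeta>) z - 2 * circle_mean ?h)
      \<longlongrightarrow> - 2 * circle_mean ?h) at_infinity"
    by simp
  show "\<forall>\<^sub>F z in at_infinity. square_transform (\<lambda>\<zeta>. \<zeta>\<^sup>2 * ?h \<zeta>) z - 2 * circle_mean ?h
      = z ^ (2 * K + 2) * square_transform g z"
    using not_in_unit_circle_at_infinity
  proof eventually_elim
    case (elim z)
    then show ?case
      using square_transform_moments_vanish[OF g elim van] square_transform_recursion[OF h elim]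
      by (simp add: power_add mult.assoc power2_eq_square)
  qed
qed

lemma square_transform_boundary_values:
  assumes g: "continuous_on unit_circle g"
    and bv: "boundary_values (cauchy_transform (\<lambda>\<zeta>. g \<zeta> / \<zeta>\<^sup>2)) fp fm"
  shows "boundary_values (square_transform g) (\<lambda>\<zeta>. fp \<zeta> + fp (- \<zeta>)) (\<lambda>\<zeta>. fm \<zeta> + fm (- \<zeta>))"
proof -
  let ?C = "cauchy_transform (\<lambda>\<zeta>. g \<zeta> / \<zeta>\<^sup>2)"
  have cont: "continuous_on unit_circle (\<lambda>\<zeta>. f \<zeta> + f (- \<zeta>))" if "continuous_on unit_circle f"
    for f :: "complex \<Rightarrow> complex"
    by (intro continuous_intros that continuous_on_compose2[OF that]) auto
  have lim: "(square_transform g \<longlongrightarrow> f \<zeta> + f (- \<zeta>)) (at \<zeta> within S)"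
    if S: "S \<inter> unit_circle = {}" "\<And>z. - z \<in> S \<longleftrightarrow> z \<in> S" and \<zeta>: "\<zeta> \<in> unit_circle"
      and f: "\<And>\<zeta>. \<zeta> \<in> unit_circle \<Longrightarrow> (?C \<longlongrightarrow> f \<zeta>) (at \<zeta> within S)" for S f \<zeta>
  proof (rule Lim_transform_eventually)
    have "filterlim uminus (at (- \<zeta>) within S) (at \<zeta> within S)"
      by (auto simp: filterlim_at eventually_at_filter S intro!: tendsto_intros)
    moreover have "(?C \<longlongrightarrow> f (- \<zeta>)) (at (- \<zeta>) within S)"
      by (rule f) (use \<zeta> in simp)
    ultimately have "((\<lambda>z. ?C (- z)) \<longlongrightarrow> f (- \<zeta>)) (at \<zeta> within S)"
      by (rule filterlim_compose[rotated])
    with f[OF \<zeta>] show "((\<lambda>z. ?C z + ?C (- z)) \<longlongrightarrow> f \<zeta> + f (- \<zeta>)) (at \<zeta> within S)"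
      by (rule tendsto_add)
    show "\<forall>\<^sub>F z in at \<zeta> within S. ?C z + ?C (- z) = square_transform g z"
      unfolding eventually_at_filter using S(1)
      by (intro always_eventually allI impI square_transform_eq_cauchy[OF g, symmetric]) blast
  qed
  show ?thesis
    using bv unfolding boundary_values_def
    by (intro conjI ballI cont lim) (auto simp: unit_circle_def)
qed

section \<open>Uniqueness for matrix jump problems\<close>

lemma tendsto_det:
  fixes Y :: "'b \<Rightarrow> complex^'n^'n"
  assumes "(Y \<longlongrightarrow> M) F"
  shows "((\<lambda>x. Determinants.det (Y x)) \<longlongrightarrow> Determinants.det M) F"
  unfolding Determinants.det_def
  by (intro tendsto_sum tendsto_mult tendsto_const tendsto_prod tendsto_vec_nth assms)

text \<open>A jump matrix of determinant 1 leaves the determinant continuous across the circle, so Liouville's theorem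
applies to it.\<close>

lemma det_constant_off_circle:
  fixes Y :: "complex \<Rightarrow> complex^'n^'n"
  assumes hol: "\<And>i j. (\<lambda>z. Y z $ i $ j) holomorphic_on - unit_circle"
    and bv: "boundary_values Y Yp Ym"
    and jump: "\<And>\<zeta>. \<zeta> \<in> unit_circle \<Longrightarrow> Yp \<zeta> = Ym \<zeta> ** J \<zeta>"
    and J: "\<And>\<zeta>. \<zeta> \<in> unit_circle \<Longrightarrow> Determinants.det (J \<zeta>) = 1"
    and lim: "((\<lambda>z. Y z ** D z) \<longlongrightarrow> M) at_infinity"
    and D: "\<forall>\<^sub>F z in at_infinity. Determinants.det (D z) = 1"
    and z: "z \<notin> unit_circle"
  shows "Determinants.det (Y z) = Determinants.det M"
proof (rule liouville_across_circle[OF _ _ _ z, where F="\<lambda>z. Determinants.det (Y z)"])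
  show "(\<lambda>z. Determinants.det (Y z)) holomorphic_on - unit_circle"
    unfolding Determinants.det_def by (intro holomorphic_intros hol)
  have eq: "Determinants.det (Yp \<zeta>) = Determinants.det (Ym \<zeta>)" if "\<zeta> \<in> unit_circle" for \<zeta>
    using that by (simp add: jump J det_mul)
  have cont: "continuous_on unit_circle (\<lambda>\<zeta>. Determinants.det (Yp \<zeta>))"
    using bv by (auto simp: boundary_values_def continuous_on_def intro: tendsto_det)
  have "((\<lambda>z. Determinants.det (Y z)) \<longlongrightarrow> Determinants.det (Yp \<zeta>)) (at \<zeta> within ball 0 1)"
    if "\<zeta> \<in> unit_circle" for \<zeta>
    using bv that by (intro tendsto_det) (simp add: boundary_values_def)
  moreover have "((\<lambda>z. Determinants.det (Y z)) \<longlongrightarrow> Determinants.det (Yp \<zeta>)) (at \<zeta> within - cball 0 1)"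
    if "\<zeta> \<in> unit_circle" for \<zeta>
    unfolding eq[OF that] using bv that by (intro tendsto_det) (simp add: boundary_values_def)
  moreover note cont
  ultimately show "boundary_values (\<lambda>z. Determinants.det (Y z))
      (\<lambda>\<zeta>. Determinants.det (Yp \<zeta>)) (\<lambda>\<zeta>. Determinants.det (Yp \<zeta>))"
    by (simp add: boundary_values_def)
  show "((\<lambda>z. Determinants.det (Y z)) \<longlongrightarrow> Determinants.det M) at_infinity"
    by (rule Lim_transform_eventually[OF tendsto_det[OF lim]])
      (use D in eventually_elim, simp add: det_mul)
qed

definition replace_row :: "'n \<Rightarrow> 'a^'m \<Rightarrow> 'a^'m^'n \<Rightarrow> 'a^'m^'n" where
  "replace_row k v A = (\<chi> i. if i = k then v else A $ i)"

lemma replace_row_mult: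
  fixes A :: "'a::semiring_1^'m^'n" and B :: "'a^'p^'m"
  shows "replace_row k v A ** B = replace_row k (v v* B) (A ** B)"
  unfolding Finite_Cartesian_Product.vec_eq_iff
  by (auto simp: replace_row_def matrix_matrix_mult_def vector_matrix_mult_def)

lemma transpose_replace_row:
  "transpose (replace_row k v A) = (\<chi> i j. if j = k then v $ i else transpose A $ i $ j)"
proof -
  have "transpose (replace_row k v A) $ i $ j = (if j = k then v $ i else transpose A $ i $ j)"
    for i j
    by (simp add: replace_row_def transpose_def)
  then show ?thesis
    unfolding Finite_Cartesian_Product.vec_eq_iff by simp
qed

lemma det_replace_row_identity:
  fixes v :: "'a::field^'n"
  shows "Determinants.det (replace_row k v (Finite_Cartesian_Product.mat 1)) = v $ k"
proof -
  have "Determinants.det (replace_row k v (Finite_Cartesian_Product.mat 1))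
      = Determinants.det (transpose (replace_row k v (Finite_Cartesian_Product.mat 1)))"
    by simp
  also have "\<dots> = v $ k"
    using cramer_lemma[of k "Finite_Cartesian_Product.mat 1" v]
    unfolding transpose_replace_row matrix_vector_mul_lid Finite_Cartesian_Product.transpose_mat
    by simp
  finally show ?thesis .
qed

lemma tendsto_replace_row:
  assumes "(v \<longlongrightarrow> v') F" "(A \<longlongrightarrow> A') F"
  shows "((\<lambda>x. replace_row k (v x) (A x)) \<longlongrightarrow> replace_row k v' A') F"
  unfolding replace_row_def
proof (intro tendsto_vec_lambda)
  show "((\<lambda>x. if i = k then v x else A x $ i) \<longlongrightarrow> (if i = k then v' else A' $ i)) F" for i
    by (cases "i = k") (auto intro: assms tendsto_vec_nth)
qed

text \<open>Cramer's rule expresses the coefficients of \<open>y z\<close> in terms of the rows of \<open>X z\<close> through determinants of \<open>X z\<close>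
with one row replaced by \<open>y z\<close>.  Such a matrix has the same jump as \<open>X\<close>, so these determinants do not
depend on \<open>z\<close> and can be read off at infinity, where they are the components of \<open>L\<close>.\<close>

proposition row_solution_unique:
  fixes X :: "complex \<Rightarrow> complex^'n^'n" and y :: "complex \<Rightarrow> complex^'n"
  assumes hol: "\<And>i j. (\<lambda>z. X z $ i $ j) holomorphic_on - unit_circle"
    and bv: "boundary_values X Xp Xm"
    and jump: "\<And>\<zeta>. \<zeta> \<in> unit_circle \<Longrightarrow> Xp \<zeta> = Xm \<zeta> ** J \<zeta>"
    and lim: "((\<lambda>z. X z ** D z) \<longlongrightarrow> Finite_Cartesian_Product.mat 1) at_infinity"
    and J: "\<And>\<zeta>. \<zeta> \<in> unit_circle \<Longrightarrow> Determinants.det (J \<zeta>) = 1"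
    and D: "\<forall>\<^sub>F z in at_infinity. Determinants.det (D z) = 1"
    and y_hol: "\<And>j. (\<lambda>z. y z $ j) holomorphic_on - unit_circle"
    and y_bv: "boundary_values y yp ym"
    and y_jump: "\<And>\<zeta>. \<zeta> \<in> unit_circle \<Longrightarrow> yp \<zeta> = ym \<zeta> v* J \<zeta>"
    and y_lim: "((\<lambda>z. y z v* D z) \<longlongrightarrow> L) at_infinity"
    and z: "z \<notin> unit_circle"
  shows "y z = L v* X z"
proof -
  have detX: "Determinants.det (X z) = 1"
    using det_constant_off_circle[OF hol bv jump J lim D z] by simp
  have minor: "Determinants.det (replace_row k (y z) (X z)) = L $ k" for k
  proof -
    have bv': "boundary_values (\<lambda>z. replace_row k (y z) (X z))
        (\<lambda>\<zeta>. replace_row k (yp \<zeta>) (Xp \<zeta>)) (\<lambda>\<zeta>. replace_row k (ym \<zeta>) (Xm \<zeta>))"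
      using bv y_bv by (auto simp: boundary_values_def continuous_on_def intro: tendsto_replace_row)
    have lim': "((\<lambda>z. replace_row k (y z) (X z) ** D z)
        \<longlongrightarrow> replace_row k L (Finite_Cartesian_Product.mat 1)) at_infinity"
      unfolding replace_row_mult by (intro tendsto_replace_row lim y_lim)
    have "(\<lambda>z. replace_row k (y z) (X z) $ i $ j) holomorphic_on - unit_circle" for i j
      by (cases "i = k") (simp_all add: replace_row_def hol y_hol)
    moreover have "replace_row k (yp \<zeta>) (Xp \<zeta>) = replace_row k (ym \<zeta>) (Xm \<zeta>) ** J \<zeta>"
      if "\<zeta> \<in> unit_circle" for \<zeta>
      using that by (simp add: replace_row_mult jump y_jump)
    ultimately have "Determinants.det (replace_row k (y z) (X z))
        = Determinants.det (replace_row k L (Finite_Cartesian_Product.mat 1))"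
      by (rule det_constant_off_circle[OF _ bv' _ J lim' D z])
    then show ?thesis
      by (simp only: det_replace_row_identity)
  qed
  have "Determinants.det (\<chi> i j. if j = k then y z $ i else transpose (X z) $ i $ j) = L $ k" for k
    unfolding transpose_replace_row [symmetric] by (simp add: minor)
  then have "L = (\<chi> k. Determinants.det (\<chi> i j. if j = k then y z $ i else transpose (X z) $ i $ j)
      / Determinants.det (transpose (X z)))"
    unfolding Finite_Cartesian_Product.vec_eq_iff by (simp add: detX)
  moreover have "Determinants.det (transpose (X z)) \<noteq> 0"
    by (simp add: detX)
  ultimately have "transpose (X z) *v L = y z"
    using cramer[of "transpose (X z)" L "y z"] by blast
  then show ?thesis
    by simp
qed

section \<open>Moment determinants and the orthogonal polynomials\<close>

definition corner_mat :: "(nat \<Rightarrow> nat \<Rightarrow> 'a) \<Rightarrow> nat \<Rightarrow> 'a Matrix.mat" where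
  "corner_mat u n = Matrix.mat n n (\<lambda>(j, k). u j k)"

text \<open>The cofactor of entry \<open>(j, n)\<close> in a matrix of size \<open>n + 1\<close> whose first \<open>n\<close> columns come from \<open>u\<close>: its minor is
made of the rows \<open>0, ..., n\<close> except \<open>j\<close>.  It does not depend on the last column, so one family of numbers
serves all the bordered determinants below.\<close>

definition border_cofactor :: "(nat \<Rightarrow> nat \<Rightarrow> 'a::comm_ring_1) \<Rightarrow> nat \<Rightarrow> nat \<Rightarrow> 'a" where
  "border_cofactor u n j =
     (- 1) ^ (j + n) * Determinant.det (corner_mat (\<lambda>i. u (if i < j then i else Suc i)) n)"

lemma det_bordered:
  "Determinant.det (corner_mat (\<lambda>j k. if k < n then u j k else b j) (Suc n))
     = (\<Sum>j\<le>n. b j * border_cofactor u n j)"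
proof -
  let ?N = "corner_mat (\<lambda>j k. if k < n then u j k else b j) (Suc n)"
  have "cofactor ?N j n = border_cofactor u n j" if "j \<le> n" for j
  proof -
    have "mat_delete ?N j n = corner_mat (\<lambda>i. u (if i < j then i else Suc i)) n"
      using that by (intro eq_matI) (auto simp: mat_delete_def corner_mat_def)
    then show ?thesis
      by (simp add: cofactor_def border_cofactor_def)
  qed
  moreover have "?N $$ (j, n) = b j" if "j \<le> n" for j
    using that by (simp add: corner_mat_def)
  moreover have "Determinant.det ?N = (\<Sum>j<Suc n. ?N $$ (j, n) * cofactor ?N j n)"
    by (rule laplace_expansion_column) (auto simp: corner_mat_def)
  ultimately show ?thesis
    by (simp add: lessThan_Suc_atMost)
qed

text \<open>Expands a bordered determinant whose last column repeats column \<open>k\<close>.\<close>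

lemma border_cofactor_orthogonal:
  assumes "k < n"
  shows "(\<Sum>j\<le>n. u j k * border_cofactor u n j) = 0"
proof -
  let ?N = "corner_mat (\<lambda>j i. if i < n then u j i else u j k) (Suc n)"
  have "Determinant.det ?N = 0"
  proof (rule det_identical_columns[of _ "Suc n" k n])
    show "Matrix.col ?N k = Matrix.col ?N n"
      using assms by (intro eq_vecI) (auto simp: corner_mat_def)
  qed (use assms in \<open>auto simp: corner_mat_def\<close>)
  then show ?thesis
    by (simp add: det_bordered[of n u "\<lambda>j. u j k"])
qed

lemma det_corner_Suc:
  "Determinant.det (corner_mat u (Suc n)) = (\<Sum>j\<le>n. u j n * border_cofactor u n j)"
proof -
  have "corner_mat u (Suc n) = corner_mat (\<lambda>j i. if i < n then u j i else u j n) (Suc n)"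
    by (intro eq_matI) (auto simp: corner_mat_def less_Suc_eq)
  then show ?thesis
    by (simp add: det_bordered[of n u "\<lambda>j. u j n"])
qed

lemma border_cofactor_last: "border_cofactor u n n = Determinant.det (corner_mat u n)"
proof -
  have "corner_mat (\<lambda>i. u (if i < n then i else Suc i)) n = corner_mat u n"
    by (intro eq_matI) (auto simp: corner_mat_def)
  then show ?thesis
    by (simp add: border_cofactor_def mult_2[symmetric])
qed

lemma det_corner_nonzero_iff:
  fixes u :: "nat \<Rightarrow> nat \<Rightarrow> 'a::field"
  shows "Determinant.det (corner_mat u n) \<noteq> 0 \<longleftrightarrow>
    (\<forall>c. (\<forall>k<n. (\<Sum>j<n. c j * u j k) = 0) \<longrightarrow> (\<forall>j<n. c j = 0))"
    (is "?L \<longleftrightarrow> ?R")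
proof -
  let ?A = "transpose_mat (corner_mat u n)"
  have A: "?A \<in> carrier_mat n n"
    by (simp add: corner_mat_def)
  have mult: "vec_index (?A *\<^sub>v Matrix.vec n c) k = (\<Sum>j<n. c j * u j k)" if "k < n" for c k
    using that by (simp add: corner_mat_def scalar_prod_def atLeast0LessThan mult.commute)
  have mult0: "?A *\<^sub>v Matrix.vec n c = 0\<^sub>v n \<longleftrightarrow> (\<forall>k<n. (\<Sum>j<n. c j * u j k) = 0)" for c
    using A mult[of _ c] by (auto simp: Matrix.vec_eq_iff)
  have vec0: "Matrix.vec n c = 0\<^sub>v n \<longleftrightarrow> (\<forall>j<n. c j = 0)" for c :: "nat \<Rightarrow> 'a"
    by (auto simp: Matrix.vec_eq_iff)
  have surj: "\<exists>c. v = Matrix.vec n c" if "v \<in> carrier_vec n" for v :: "'a Matrix.vec"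
    using that by (metis eq_vecI carrier_vecD dim_vec index_vec)
  have "Determinant.det (corner_mat u n) = Determinant.det ?A"
    by (rule det_transpose [of _ n, symmetric]) (simp add: corner_mat_def)
  also have "\<dots> = 0 \<longleftrightarrow> (\<exists>c. Matrix.vec n c \<noteq> 0\<^sub>v n \<and> ?A *\<^sub>v Matrix.vec n c = 0\<^sub>v n)"
    unfolding det_0_iff_vec_prod_zero_field[OF A] using surj vec_carrier by blast
  finally have "Determinant.det (corner_mat u n) = 0 \<longleftrightarrow>
      (\<exists>c. \<not> (\<forall>j<n. c j = 0) \<and> (\<forall>k<n. (\<Sum>j<n. c j * u j k) = 0))"
    unfolding mult0 vec0 .
  note det_0 = this
  have logic: "(P \<longleftrightarrow> (\<exists>c. \<not> A c \<and> B c)) \<Longrightarrow> (\<not> P \<longleftrightarrow> (\<forall>c. B c \<longrightarrow> A c))"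
    for P and A B :: "(nat \<Rightarrow> 'a) \<Rightarrow> bool"
    by blast
  show ?thesis
    by (rule logic) (rule det_0)
qed

text \<open>The coefficients of the monic orthogonal polynomial are the normalised border cofactors.  Existence is
\<open>border_cofactor_orthogonal\<close>; uniqueness holds because the difference of two solutions is a kernel vector
of the invertible corner of size \<open>n\<close>.\<close>

lemma monic_kernel_iff_cofactors:
  fixes u :: "nat \<Rightarrow> nat \<Rightarrow> 'a::field" and n :: nat
  defines "E \<equiv> Determinant.det (corner_mat u n)"
  assumes E: "E \<noteq> 0"
  shows "c n = 1 \<and> (\<forall>k<n. (\<Sum>j\<le>n. c j * u j k) = 0) \<longleftrightarrow>
    (\<forall>j\<le>n. c j = border_cofactor u n j / E)"
proof
  let ?d = "\<lambda>j. border_cofactor u n j / E"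
  have d: "(\<Sum>j\<le>n. ?d j * u j k) = 0" if "k < n" for k
    using border_cofactor_orthogonal[OF that, of u]
    by (simp add: sum_divide_distrib[symmetric] mult.commute)
  have dn: "?d n = 1"
    using E by (simp add: border_cofactor_last E_def)
  {
    assume c: "\<forall>j\<le>n. c j = ?d j"
    then have "(\<Sum>j\<le>n. c j * u j k) = (\<Sum>j\<le>n. ?d j * u j k)" for k
      by (intro sum.cong) auto
    moreover have "c n = ?d n"
      using c by blast
    ultimately show "c n = 1 \<and> (\<forall>k<n. (\<Sum>j\<le>n. c j * u j k) = 0)"
      using d dn by simp
  next
    assume c: "c n = 1 \<and> (\<forall>k<n. (\<Sum>j\<le>n. c j * u j k) = 0)"
    have "(\<Sum>j<n. (c j - ?d j) * u j k) = 0" if "k < n" for k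
    proof -
      have "(\<Sum>j\<le>n. (c j - ?d j) * u j k) = 0"
        using c d[OF that] that by (simp add: left_diff_distrib sum_subtractf)
      then show ?thesis
        using c dn by (simp add: lessThan_Suc_atMost[symmetric])
    qed
    then have "\<forall>j<n. c j - ?d j = 0"
      using E[unfolded E_def det_corner_nonzero_iff, THEN spec[of _ "\<lambda>j. c j - ?d j"]] by simp
    then show "\<forall>j\<le>n. c j = ?d j"
      using c dn by (auto simp: le_less)
  }
qed

text \<open>Row index \<open>j\<close> is a power of \<open>1 / \<zeta>\<close> in a polynomial, column index \<open>k\<close> a test function \<open>\<zeta> powi (2 * k - s)\<close>.\<close>

definition moment_entry :: "(complex \<Rightarrow> complex) \<Rightarrow> int \<Rightarrow> nat \<Rightarrow> nat \<Rightarrow> complex" where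
  "moment_entry w s j k = moment w (int j - 2 * int k + s)"

lemma E_det_eq_corner: "E_det w s n = Determinant.det (corner_mat (moment_entry w s) n)"
  by (simp add: E_det_def corner_mat_def moment_entry_def)

lemma moment_entry_Suc: "moment_entry w s (Suc i) k = moment_entry w (s + 1) i k"
  unfolding moment_entry_def by (rule arg_cong[of _ _ "moment w"]) simp

text \<open>Omitting row 0 shifts every row by one, which is the shift \<open>s \<mapsto> s + 1\<close>; omitting row 1 instead gives the
determinant with the hat.  Up to sign these are the
numerators of \<open>S_n(0)\<close> and \<open>S_n'(0)\<close>.\<close>

lemma border_cofactor_0: "border_cofactor (moment_entry w s) n 0 = (- 1) ^ n * E_det w (s + 1) n"
proof -
  have "corner_mat (\<lambda>i. moment_entry w s (if i < 0 then i else Suc i)) n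
      = corner_mat (moment_entry w (s + 1)) n"
    by (intro eq_matI) (auto simp: corner_mat_def moment_entry_Suc)
  then show ?thesis
    unfolding border_cofactor_def E_det_eq_corner by simp
qed

lemma border_cofactor_1: "border_cofactor (moment_entry w s) n 1 = (- 1) ^ (n + 1) * Ehat_det w s n"
proof -
  have row: "moment_entry w s (if i = 0 then i else Suc i) k
      = moment w ((if i = 0 then 0 else int i + 1) - 2 * int k + s)" for i k
    unfolding moment_entry_def by (rule arg_cong[of _ _ "moment w"]) simp
  have "corner_mat (\<lambda>i. moment_entry w s (if i < 1 then i else Suc i)) n
      = Matrix.mat n n (\<lambda>(j, k). moment w ((if j = 0 then 0 else int j + 1) - 2 * int k + s))"
    by (intro eq_matI) (simp_all add: corner_mat_def row)
  then show ?thesis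
    unfolding border_cofactor_def Ehat_det_def by simp
qed

lemma circle_mean_poly_inverse:
  assumes w: "continuous_on unit_circle w"
  shows "circle_mean (\<lambda>\<zeta>. poly p (inverse \<zeta>) * \<zeta> powi (2 * int k - s) * w \<zeta>)
    = (\<Sum>j\<le>degree p. coeff p j * moment_entry w s j k)"
proof -
  let ?e = "\<lambda>j \<zeta>. coeff p j * (w \<zeta> * \<zeta> powi (- (int j - 2 * int k + s)))"
  have "circle_mean (\<lambda>\<zeta>. poly p (inverse \<zeta>) * \<zeta> powi (2 * int k - s) * w \<zeta>)
      = circle_mean (\<lambda>\<zeta>. \<Sum>j\<le>degree p. ?e j \<zeta>)"
  proof (rule circle_mean_cong)
    fix \<zeta> assume "\<zeta> \<in> unit_circle"
    then have "\<zeta> \<noteq> 0" by (auto simp: unit_circle_def)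
    then have "inverse \<zeta> ^ j * \<zeta> powi (2 * int k - s) = \<zeta> powi (- int j + (2 * int k - s))" for j
      by (subst power_int_add) (auto simp: power_int_minus power_inverse)
    then have pow: "inverse \<zeta> ^ j * \<zeta> powi (2 * int k - s) = \<zeta> powi (- (int j - 2 * int k + s))" for j
      by (simp add: algebra_simps)
    show "poly p (inverse \<zeta>) * \<zeta> powi (2 * int k - s) * w \<zeta> = (\<Sum>j\<le>degree p. ?e j \<zeta>)"
      unfolding pow [symmetric] poly_altdef sum_distrib_right by (simp only: mult_ac)
  qed
  also have "\<dots> = (\<Sum>j\<le>degree p. circle_mean (?e j))"
    by (intro circle_mean_sum continuous_intros w) (auto simp: unit_circle_def)
  finally show ?thesis
    by (simp add: circle_mean_cmult moment_entry_def moment_def)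
qed

lemma is_S_poly_iff_cofactors:
  assumes w: "continuous_on unit_circle w" and E: "E_det w s n \<noteq> 0"
  shows "is_S_poly w s n p \<longleftrightarrow>
    (\<forall>j. coeff p j = (if j \<le> n then border_cofactor (moment_entry w s) n j / E_det w s n else 0))"
proof -
  let ?u = "moment_entry w s"
  have deg: "degree p = n \<and> lead_coeff p = 1 \<longleftrightarrow> coeff p n = 1 \<and> (\<forall>j>n. coeff p j = 0)"
  proof
    assume "coeff p n = 1 \<and> (\<forall>j>n. coeff p j = 0)"
    moreover from this have "degree p = n"
      by (intro antisym degree_le le_degree) auto
    ultimately show "degree p = n \<and> lead_coeff p = 1"
      by simp
  qed (auto intro: coeff_eq_0)
  have "is_S_poly w s n p \<longleftrightarrow>
      (\<forall>j>n. coeff p j = 0) \<and> coeff p n = 1 \<and> (\<forall>k<n. (\<Sum>j\<le>n. coeff p j * ?u j k) = 0)"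
    unfolding is_S_poly_def circle_mean_poly_inverse[OF w] using deg by auto
  also have "\<dots> \<longleftrightarrow> (\<forall>j>n. coeff p j = 0) \<and>
      (\<forall>j\<le>n. coeff p j = border_cofactor ?u n j / E_det w s n)"
    using monic_kernel_iff_cofactors[of ?u n "coeff p"] E by (simp add: E_det_eq_corner)
  also have "\<dots> \<longleftrightarrow> (\<forall>j. coeff p j =
      (if j \<le> n then border_cofactor ?u n j / E_det w s n else 0))"
    by (auto simp: not_le)
  finally show ?thesis .
qed

lemma S_poly_exists_unique:
  assumes w: "continuous_on unit_circle w" and E: "E_det w s n \<noteq> 0"
  shows "\<exists>!p. is_S_poly w s n p"
proof -
  let ?c = "\<lambda>j. if j \<le> n then border_cofactor (moment_entry w s) n j / E_det w s n else 0"
  have "coeff (Abs_poly ?c) = ?c"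
    by (rule Abs_poly_inverse) (auto simp: MOST_nat intro!: exI[of _ n])
  then have "is_S_poly w s n p \<longleftrightarrow> p = Abs_poly ?c" for p
    unfolding is_S_poly_iff_cofactors[OF assms] poly_eq_iff by simp
  then show ?thesis
    by simp
qed

lemma is_S_poly_S_poly:
  assumes "continuous_on unit_circle w" "E_det w s n \<noteq> 0"
  shows "is_S_poly w s n (S_poly w s n)"
  unfolding S_poly_def by (rule theI'[OF S_poly_exists_unique[OF assms]])

lemma coeff_S_poly:
  assumes "continuous_on unit_circle w" "E_det w s n \<noteq> 0" "j \<le> n"
  shows "coeff (S_poly w s n) j = border_cofactor (moment_entry w s) n j / E_det w s n"
  using is_S_poly_S_poly[OF assms(1,2)] assms by (simp add: is_S_poly_iff_cofactors)

lemma S_poly_at_0: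
  assumes "continuous_on unit_circle w" "E_det w s n \<noteq> 0"
  shows "poly (S_poly w s n) 0 = (- 1) ^ n * E_det w (s + 1) n / E_det w s n"
  using coeff_S_poly[OF assms, of 0] by (simp add: poly_0_coeff_0 border_cofactor_0)

lemma S_poly_deriv_at_0:
  assumes "continuous_on unit_circle w" "E_det w s n \<noteq> 0" "n \<ge> 1"
  shows "poly (pderiv (S_poly w s n)) 0 = (- 1) ^ (n + 1) * Ehat_det w s n / E_det w s n"
  using coeff_S_poly[OF assms(1,2), of 1] assms(3)
  by (simp add: poly_0_coeff_0 coeff_pderiv border_cofactor_1[unfolded One_nat_def])

text \<open>The first moment that need not vanish, obtained by expanding the determinant of size \<open>n + 1\<close> along its last
column.\<close>

lemma S_poly_next_moment:
  assumes "continuous_on unit_circle w" "E_det w s n \<noteq> 0"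
  shows "(\<Sum>j\<le>n. coeff (S_poly w s n) j * moment_entry w s j n) = g_coeff w s n"
  using assms
  by (simp add: coeff_S_poly g_coeff_def E_det_eq_corner[of w s "Suc n"] det_corner_Suc
      sum_divide_distrib mult.commute)

section \<open>Rows generated by polynomials\<close>

text \<open>The odd part of \<open>p\<close> divided by the variable, so that \<open>sym_quotient p\<close> is a polynomial function.\<close>

definition odd_quotient :: "complex poly \<Rightarrow> complex poly" where
  "odd_quotient p = (\<Sum>i\<le>degree p. if odd i then monom (coeff p i) (i - 1) else 0)"

lemma coeff_odd_quotient:
  "coeff (odd_quotient p) k = (if even k then coeff p (Suc k) else 0)"
proof -
  have "coeff (if odd i then monom (coeff p i) (i - 1) else 0) k
      = (if i = Suc k then if even k then coeff p (Suc k) else 0 else 0)" for i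
    by (auto elim: oddE)
  then have "coeff (odd_quotient p) k
      = (\<Sum>i\<le>degree p. if i = Suc k then if even k then coeff p (Suc k) else 0 else 0)"
    by (simp only: odd_quotient_def coeff_sum)
  also have "\<dots> = (if even k then coeff p (Suc k) else 0)"
    by (auto simp: not_le coeff_eq_0)
  finally show ?thesis .
qed

lemma sym_quotient_eq_poly: "sym_quotient p z = poly (odd_quotient p) z"
proof (cases "z = 0")
  case True
  then show ?thesis
    by (simp add: sym_quotient_def poly_0_coeff_0 coeff_pderiv coeff_odd_quotient)
next
  case False
  have "(poly p z - poly p (- z)) / (2 * z)
      = (\<Sum>i\<le>degree p. coeff p i * (z ^ i - (- z) ^ i) / (2 * z))"
    by (simp only: poly_altdef right_diff_distrib sum_subtractf [symmetric] sum_divide_distrib [symmetric])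
  also have "\<dots> = (\<Sum>i\<le>degree p. poly (if odd i then monom (coeff p i) (i - 1) else 0) z)"
  proof (intro sum.cong refl)
    fix i
    show "coeff p i * (z ^ i - (- z) ^ i) / (2 * z)
        = poly (if odd i then monom (coeff p i) (i - 1) else 0) z"
    proof (cases "odd i")
      case True
      then obtain j where "i = Suc (2 * j)" by (auto elim: oddE)
      with False show ?thesis
        by (simp add: poly_monom)
    qed simp
  qed
  finally show ?thesis
    using False by (simp add: sym_quotient_def odd_quotient_def poly_sum)
qed

text \<open>The odd coefficients of \<open>p\<close> have index at most \<open>2 * m - 1\<close>, and dividing by the variable lowers this by one.\<close>

lemma degree_odd_quotient:
  assumes "degree p \<le> 2 * m"
  shows "degree (odd_quotient p) \<le> 2 * m - 2"
proof (rule degree_le, intro allI impI)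
  fix k assume "2 * m - 2 < k"
  then have "odd k \<or> 2 * m < Suc k" by presburger
  with assms show "coeff (odd_quotient p) k = 0"
    by (auto simp: coeff_odd_quotient intro: coeff_eq_0)
qed

lemma tendsto_poly_over_power:
  fixes p :: "complex poly"
  assumes "degree p \<le> N"
  shows "((\<lambda>z. poly p z * z powi (- int N)) \<longlongrightarrow> coeff p N) at_infinity"
proof (rule Lim_transform_eventually)
  have "((\<lambda>z::complex. coeff p i * inverse z ^ (N - i))
      \<longlongrightarrow> (if i = N then coeff p i else 0)) at_infinity" if "i \<le> N" for i
  proof (cases "i = N")
    case False
    with that have "((\<lambda>z::complex. inverse z ^ (N - i)) \<longlongrightarrow> 0 ^ (N - i)) at_infinity"
      by (intro tendsto_power tendsto_inverse_0)
    moreover have "(0::complex) ^ (N - i) = 0"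
      by (rule zero_power) (use False that in simp)
    ultimately show ?thesis
      using False by (simp add: tendsto_mult_right_zero)
  qed simp
  then have "((\<lambda>z::complex. \<Sum>i\<le>N. coeff p i * inverse z ^ (N - i))
      \<longlongrightarrow> (\<Sum>i\<le>N. if i = N then coeff p i else 0)) at_infinity"
    by (intro tendsto_sum) auto
  then show "((\<lambda>z::complex. \<Sum>i\<le>N. coeff p i * inverse z ^ (N - i)) \<longlongrightarrow> coeff p N) at_infinity"
    by simp
  have "(\<Sum>i\<le>N. coeff p i * inverse z ^ (N - i)) = poly p z * z powi (- int N)"
    if z: "z \<noteq> 0" for z :: complex
  proof -
    have "poly p z = (\<Sum>i\<le>N. coeff p i * z ^ i)"
      unfolding poly_altdef using assms
      by (intro sum.mono_neutral_left) (auto intro: coeff_eq_0)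
    moreover have "z ^ i * z powi (- int N) = inverse z ^ (N - i)" if "i \<le> N" for i
    proof -
      have "z ^ N = z ^ i * z ^ (N - i)"
        using that by (simp add: power_add [symmetric])
      then show ?thesis
        using z by (simp add: power_int_minus power_inverse)
    qed
    ultimately show ?thesis
      by (simp add: sum_distrib_right mult.assoc)
  qed
  moreover have "\<forall>\<^sub>F z in at_infinity. z \<noteq> (0::complex)"
    by (auto simp: eventually_at_infinity intro!: exI[of _ 1])
  ultimately show "\<forall>\<^sub>F z in at_infinity.
      (\<Sum>i\<le>N. coeff p i * inverse z ^ (N - i)) = poly p z * z powi (- int N)"
    by (auto elim: eventually_mono)
qed

text \<open>\<open>z ^ N * S (1 / z)\<close> for the polynomial \<open>S\<close> with coefficients \<open>c\<close>.  The degree \<open>N\<close> is prescribed rather than read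
off from \<open>c\<close>, because polynomials \<open>S\<close> of several degrees have to be compared at the same \<open>N\<close>.\<close>

definition reversed_poly :: "nat \<Rightarrow> (nat \<Rightarrow> complex) \<Rightarrow> complex poly" where
  "reversed_poly N c = (\<Sum>j\<le>N. monom (c j) (N - j))"

lemma poly_reversed_poly: "poly (reversed_poly N c) z = (\<Sum>j\<le>N. c j * z ^ (N - j))"
  by (simp add: reversed_poly_def poly_sum poly_monom)

lemma coeff_reversed_poly: "coeff (reversed_poly N c) i = (if i \<le> N then c (N - i) else 0)"
proof -
  have "coeff (reversed_poly N c) i = (\<Sum>j\<le>N. if N - j = i then c j else 0)"
    by (simp add: reversed_poly_def coeff_sum)
  also have "\<dots> = (\<Sum>j\<le>N. if j = N - i then if i \<le> N then c j else 0 else 0)"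
    by (intro sum.cong refl) auto
  finally show ?thesis
    by simp
qed

lemma degree_reversed_poly: "degree (reversed_poly N c) \<le> N"
  by (rule degree_le) (simp add: coeff_reversed_poly)

lemma reversed_poly_coeff:
  assumes "degree p = n" "n \<le> N"
  shows "reversed_poly N (coeff p) = monom 1 (N - n) * reflect_poly p"
  using assms
  by (auto simp: poly_eq_iff coeff_reversed_poly coeff_monom_mult coeff_reflect_poly
      not_less intro!: coeff_eq_0 arg_cong[of _ _ "coeff p"])

lemma poly_reversed_poly_coeff:
  assumes "degree p \<le> N" "z \<noteq> 0"
  shows "poly (reversed_poly N (coeff p)) z = z ^ N * poly p (inverse z)"
proof -
  have poly_sum: "poly p (inverse z) = (\<Sum>j\<le>N. coeff p j * inverse z ^ j)"
    unfolding poly_altdef using assms(1)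
    by (intro sum.mono_neutral_left) (auto intro: coeff_eq_0)
  have summand: "z ^ N * (a * inverse z ^ j) = a * z ^ (N - j)" if "j \<le> N" for j a
  proof -
    have "z ^ N = z ^ (N - j) * z ^ j"
      using that by (simp add: power_add [symmetric])
    then show ?thesis
      using assms(2) by (simp add: power_inverse)
  qed
  show ?thesis
    unfolding poly_reversed_poly poly_sum sum_distrib_left
    by (intro sum.cong refl) (simp only: summand atMost_iff)
qed

text \<open>With \<open>p\<close> equal to \<open>z ^ (2 * m) * S (1 / z)\<close> this is \<open>w \<zeta> * \<zeta> powi (- s) * S (1 / \<zeta>)\<close>, whose even moments are the
orthogonality integrals of \<open>S\<close>.\<close>

definition row_symbol :: "(complex \<Rightarrow> complex) \<Rightarrow> nat \<Rightarrow> int \<Rightarrow> complex poly \<Rightarrow> complex \<Rightarrow> complex" where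
  "row_symbol w m s p \<zeta> = w \<zeta> * \<zeta> powi (- 2 * int m - s) * poly p \<zeta>"

lemma continuous_row_symbol:
  assumes "continuous_on unit_circle w"
  shows "continuous_on unit_circle (row_symbol w m s p)"
  unfolding row_symbol_def
  by (intro continuous_intros assms) (auto simp: unit_circle_def)

lemma row_symbol_moment:
  assumes w: "continuous_on unit_circle w"
  shows "circle_mean (\<lambda>\<zeta>. \<zeta> ^ (2 * k) * row_symbol w m s (reversed_poly (2 * m) c) \<zeta>)
    = (\<Sum>j\<le>2 * m. c j * moment_entry w s j k)"
proof -
  let ?e = "\<lambda>j \<zeta>. c j * (w \<zeta> * \<zeta> powi (- (int j - 2 * int k + s)))"
  have "circle_mean (\<lambda>\<zeta>. \<zeta> ^ (2 * k) * row_symbol w m s (reversed_poly (2 * m) c) \<zeta>)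
      = circle_mean (\<lambda>\<zeta>. \<Sum>j\<le>2 * m. ?e j \<zeta>)"
  proof (rule circle_mean_cong)
    fix \<zeta> assume "\<zeta> \<in> unit_circle"
    then have nz: "\<zeta> \<noteq> 0" by (auto simp: unit_circle_def)
    have pow: "\<zeta> ^ (2 * k) * (\<zeta> powi (- 2 * int m - s) * \<zeta> ^ (2 * m - j))
        = \<zeta> powi (- (int j - 2 * int k + s))" if "j \<le> 2 * m" for j
    proof -
      have "\<zeta> powi int (2 * k) * (\<zeta> powi (- 2 * int m - s) * \<zeta> powi int (2 * m - j))
          = \<zeta> powi (int (2 * k) + ((- 2 * int m - s) + int (2 * m - j)))"
        using nz by (simp only: power_int_add simp_thms)
      also have "int (2 * k) + ((- 2 * int m - s) + int (2 * m - j)) = - (int j - 2 * int k + s)"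
        using that by (simp add: of_nat_diff)
      finally show ?thesis
        unfolding power_int_of_nat .
    qed
    have "\<zeta> ^ (2 * k) * row_symbol w m s (reversed_poly (2 * m) c) \<zeta>
        = (\<Sum>j\<le>2 * m. c j * (w \<zeta> * (\<zeta> ^ (2 * k) * (\<zeta> powi (- 2 * int m - s) * \<zeta> ^ (2 * m - j)))))"
      unfolding row_symbol_def poly_reversed_poly sum_distrib_left by (simp only: mult_ac)
    also have "\<dots> = (\<Sum>j\<le>2 * m. ?e j \<zeta>)"
      by (intro sum.cong refl) (simp only: pow atMost_iff)
    finally show "\<zeta> ^ (2 * k) * row_symbol w m s (reversed_poly (2 * m) c) \<zeta> = (\<Sum>j\<le>2 * m. ?e j \<zeta>)" .
  qed
  also have "\<dots> = (\<Sum>j\<le>2 * m. circle_mean (?e j))"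
    by (intro circle_mean_sum continuous_intros w) (auto simp: unit_circle_def)
  finally show ?thesis
    by (simp add: circle_mean_cmult moment_entry_def moment_def)
qed

text \<open>The row with first entry \<open>p\<close> that has the jump of the Riemann-Hilbert problem; for \<open>p\<close> the reversal of an
orthogonal polynomial it is a row of \<open>S_H_matrix\<close>.\<close>

definition rhp_row :: "(complex \<Rightarrow> complex) \<Rightarrow> nat \<Rightarrow> int \<Rightarrow> complex poly \<Rightarrow> complex \<Rightarrow> complex^3" where
  "rhp_row w m s p z =
     vector [poly p z, sym_quotient p z, square_transform (row_symbol w m s p) z]"

text \<open>The two entries of the jump matrix are built so that this combination is \<open>g \<zeta> + g (- \<zeta>)\<close> with
\<open>g \<zeta> = w \<zeta> * \<zeta> powi k * p \<zeta>\<close>, which is exactly the jump of a Cauchy transform with even kernel.\<close>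

lemma jump_row_identity:
  fixes m :: nat and s :: int
  assumes nz: "\<zeta> \<noteq> 0"
  defines "k \<equiv> - 2 * int m - s - 2"
  shows "poly p \<zeta> * k1 w m s \<zeta> + sym_quotient p \<zeta> * k2 w m s \<zeta>
    = w \<zeta> * (\<zeta> powi k * poly p \<zeta>) + w (- \<zeta>) * ((- \<zeta>) powi k * poly p (- \<zeta>))"
proof -
  \<comment> \<open>The common value of \<open>(- 1) powi s\<close> and \<open>(- 1) powi k\<close>, since \<open>k\<close> and \<open>s\<close> have the same parity.\<close>
  define e :: complex where "e = (if even s then 1 else - 1)"
  have "(- 1) powi s = e"
    by (simp add: e_def power_int_minus_left)
  then have k1: "k1 w m s \<zeta> = \<zeta> powi k * (w \<zeta> + e * w (- \<zeta>))"
    by (simp add: k1_def k_def)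
  have "(- 1) powi (s + 1) = - e"
    by (simp add: e_def power_int_minus_left)
  moreover have "\<zeta> powi (- 2 * int m - s - 1) = \<zeta> powi k * \<zeta>"
    using power_int_add_1[of \<zeta> k] nz by (simp add: k_def)
  ultimately have k2: "k2 w m s \<zeta> = - 2 * e * (\<zeta> powi k * \<zeta>) * w (- \<zeta>)"
    by (simp add: k2_def)
  have k3: "(- \<zeta>) powi k = e * \<zeta> powi k"
    by (simp add: power_int_minus_left e_def k_def)
  have "2 * \<zeta> * sym_quotient p \<zeta> = poly p \<zeta> - poly p (- \<zeta>)"
    using nz by (simp add: sym_quotient_def)
  then have "poly p (- \<zeta>) = poly p \<zeta> - 2 * \<zeta> * sym_quotient p \<zeta>"
    by simp
  then show ?thesis
    unfolding k1 k2 k3 by (simp only:) (simp add: algebra_simps)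
qed

lemma vector_3_mult_jump:
  "(vector [a, b, c] :: complex^3) v* jump_matrix w m s z
    = vector [a, b, a * k1 w m s z + b * k2 w m s z + c]"
  unfolding Finite_Cartesian_Product.vec_eq_iff forall_3
  by (simp add: jump_matrix_def vector_matrix_mult_def sum_3)

lemma tendsto_vector_3:
  fixes f g h :: "'b \<Rightarrow> complex"
  assumes "(f \<longlongrightarrow> a) F" "(g \<longlongrightarrow> b) F" "(h \<longlongrightarrow> c) F"
  shows "((\<lambda>x. vector [f x, g x, h x] :: complex^3) \<longlongrightarrow> vector [a, b, c]) F"
proof (rule vec_tendstoI)
  fix i :: 3
  show "((\<lambda>x. (vector [f x, g x, h x] :: complex^3) $ i) \<longlongrightarrow> vector [a, b, c] $ i) F"
    using exhaust_3[of i] assms by auto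
qed

lemma sym_quotient_holomorphic: "sym_quotient p holomorphic_on S"
  unfolding sym_quotient_eq_poly [abs_def] by (intro holomorphic_intros)

lemma rhp_row_holomorphic:
  assumes "continuous_on unit_circle w"
  shows "(\<lambda>z. rhp_row w m s p z $ j) holomorphic_on - unit_circle"
  using exhaust_3[of j] square_transform_holomorphic[OF continuous_row_symbol[OF assms]]
  by (auto simp: rhp_row_def intro!: holomorphic_intros sym_quotient_holomorphic)

lemma rhp_row_jump:
  assumes reg: "plemelj_regular w"
  obtains yp ym where "boundary_values (rhp_row w m s p) yp ym"
    "\<And>\<zeta>. \<zeta> \<in> unit_circle \<Longrightarrow> yp \<zeta> = ym \<zeta> v* jump_matrix w m s \<zeta>"
proof -
  define k where "k = - 2 * int m - s - 2"
  have w: "continuous_on unit_circle w"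
    using reg by (simp add: plemelj_regular_def)
  obtain fp fm where bv: "boundary_values (cauchy_transform (\<lambda>\<zeta>. w \<zeta> * (\<zeta> powi k * poly p \<zeta>))) fp fm"
    and pl: "\<And>\<zeta>. \<zeta> \<in> unit_circle \<Longrightarrow> fp \<zeta> - fm \<zeta> = w \<zeta> * (\<zeta> powi k * poly p \<zeta>)"
    using reg unfolding plemelj_regular_def by blast
  \<comment> \<open>The division by \<open>\<zeta>\<^sup>2\<close> in the even kernel explains the exponent \<open>- 2 * m - s - 2\<close> of the jump.\<close>
  have "cauchy_transform (\<lambda>\<zeta>. row_symbol w m s p \<zeta> / \<zeta>\<^sup>2)
      = cauchy_transform (\<lambda>\<zeta>. w \<zeta> * (\<zeta> powi k * poly p \<zeta>))"
  proof (rule cauchy_transform_cong)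
    fix \<zeta> assume "\<zeta> \<in> unit_circle"
    then have "\<zeta> \<noteq> 0" by (auto simp: unit_circle_def)
    then have "\<zeta> powi k = \<zeta> powi (- 2 * int m - s) / \<zeta>\<^sup>2"
      using power_int_diff[of \<zeta> "- 2 * int m - s" 2] by (simp add: k_def)
    then show "row_symbol w m s p \<zeta> / \<zeta>\<^sup>2 = w \<zeta> * (\<zeta> powi k * poly p \<zeta>)"
      by (simp add: row_symbol_def)
  qed
  with square_transform_boundary_values[OF continuous_row_symbol[OF w], of m s p fp fm] bv
  have sq: "boundary_values (square_transform (row_symbol w m s p))
      (\<lambda>\<zeta>. fp \<zeta> + fp (- \<zeta>)) (\<lambda>\<zeta>. fm \<zeta> + fm (- \<zeta>))"
    by simp
  let ?y = "\<lambda>f \<zeta>. vector [poly p \<zeta>, sym_quotient p \<zeta>, f \<zeta> + f (- \<zeta>)] :: complex^3"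
  have cont: "((\<lambda>z. poly p z) \<longlongrightarrow> poly p \<zeta>) (at \<zeta> within S)"
    "((\<lambda>z. sym_quotient p z) \<longlongrightarrow> sym_quotient p \<zeta>) (at \<zeta> within S)" for \<zeta> S
    unfolding sym_quotient_eq_poly by (intro tendsto_intros)+
  show thesis
  proof
    show "boundary_values (rhp_row w m s p) (?y fp) (?y fm)"
      using sq unfolding boundary_values_def rhp_row_def continuous_on_def
      by (intro conjI ballI tendsto_vector_3 cont) auto
    show "?y fp \<zeta> = ?y fm \<zeta> v* jump_matrix w m s \<zeta>" if \<zeta>: "\<zeta> \<in> unit_circle" for \<zeta>
    proof -
      have "\<zeta> \<noteq> 0" using \<zeta> by (auto simp: unit_circle_def)
      from jump_row_identity[OF this, of p w m s] pl[OF \<zeta>] pl[of "- \<zeta>"] \<zeta>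
      have "fp \<zeta> + fp (- \<zeta>)
          = poly p \<zeta> * k1 w m s \<zeta> + sym_quotient p \<zeta> * k2 w m s \<zeta> + (fm \<zeta> + fm (- \<zeta>))"
        by (simp add: k_def algebra_simps)
      then show ?thesis
        by (simp only: vector_3_mult_jump)
    qed
  qed
qed

section \<open>The solution of the Riemann-Hilbert problem at infinity and at 0\<close>

lemma det_diag3: "Determinants.det (diag3 a b c) = a * b * c"
  by (simp add: Determinants.det_3 diag3_def)

lemma det_jump_matrix: "Determinants.det (jump_matrix w m s z) = 1"
  by (simp add: Determinants.det_3 jump_matrix_def)

lemma diag3_mult: "diag3 a b c ** diag3 a' b' c' = diag3 (a * a') (b * b') (c * c')"
  unfolding Finite_Cartesian_Product.vec_eq_iff forall_3
  by (simp add: diag3_def matrix_matrix_mult_def sum_3)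

lemma diag3_one: "diag3 1 1 1 = Finite_Cartesian_Product.mat 1"
  unfolding Finite_Cartesian_Product.vec_eq_iff forall_3
  by (simp add: diag3_def Finite_Cartesian_Product.mat_def)

lemma vector_3_mult_diag3:
  "(vector [x, y, z] :: complex^3) v* diag3 a b c = vector [x * a, y * b, z * c]"
  unfolding Finite_Cartesian_Product.vec_eq_iff forall_3
  by (simp add: diag3_def vector_matrix_mult_def sum_3)

text \<open>The inverse of the diagonal growth factor in the condition at infinity.\<close>

definition rhp_normalizer :: "nat \<Rightarrow> complex \<Rightarrow> complex^3^3" where
  "rhp_normalizer m z =
     diag3 (z powi (- 2 * int m)) (z powi (2 - 2 * int m)) (z powi (4 * int m - 2))"

lemma eventually_nonzero_at_infinity: "\<forall>\<^sub>F z in at_infinity. z \<noteq> (0::complex)"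
  by (auto simp: eventually_at_infinity intro!: exI[of _ 1])

lemma det_rhp_normalizer: "\<forall>\<^sub>F z in at_infinity. Determinants.det (rhp_normalizer m z) = 1"
  using eventually_nonzero_at_infinity
  by eventually_elim (simp add: rhp_normalizer_def det_diag3 power_int_add [symmetric])

lemma bigo_powi_tendsto_0:
  fixes f :: "complex \<Rightarrow> complex"
  assumes "f \<in> O[at_infinity](\<lambda>z. z powi (- int (Suc n)))"
  shows "((\<lambda>z. z ^ n * f z) \<longlongrightarrow> 0) at_infinity"
proof -
  obtain c where c: "\<forall>\<^sub>F z in at_infinity. norm (f z) \<le> c * norm (z powi (- int (Suc n)))"
    using assms by (elim landau_o.bigE)
  show ?thesis
  proof (rule Lim_null_comparison)
    show "\<forall>\<^sub>F z in at_infinity. norm (z ^ n * f z) \<le> c * norm (inverse z)"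
      using c eventually_nonzero_at_infinity
    proof eventually_elim
      case (elim z)
      have "norm (z ^ n * f z) \<le> norm (z ^ n) * (c * norm (z powi (- int (Suc n))))"
        unfolding norm_mult by (intro mult_left_mono elim) auto
      also have "\<dots> = c * norm (z ^ n * z powi (- int (Suc n)))"
        by (simp only: norm_mult mult_ac)
      also have "z ^ n * z powi (- int (Suc n)) = inverse z"
        using elim by (simp only: power_int_minus power_int_of_nat) simp
      finally show ?case .
    qed
    show "((\<lambda>z::complex. c * norm (inverse z)) \<longlongrightarrow> 0) at_infinity"
      by (intro tendsto_mult_right_zero tendsto_norm_zero tendsto_inverse_0)
  qed
qed

lemma rhp_infinity_normalized:
  assumes "rhp_infinity m X"
  shows "((\<lambda>z. X z ** rhp_normalizer m z) \<longlongrightarrow> Finite_Cartesian_Product.mat 1) at_infinity"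
proof -
  obtain X2 :: "complex^3^3" and R :: "complex \<Rightarrow> complex^3^3" where
    R: "\<And>i j. (\<lambda>z. R z $ i $ j) \<in> O[at_infinity](\<lambda>z. z powi (- 3))" and
    X: "\<forall>\<^sub>F z in at_infinity. X z = (\<chi> i j. (if i = j then 1 else 0) + X1_inf $ i $ j / z
        + X2 $ i $ j / z\<^sup>2 + R z $ i $ j)
        ** diag3 (z powi (2 * int m)) (z powi (2 * int m - 2)) (z powi (- 4 * int m + 2))"
    using assms unfolding rhp_infinity_def by blast
  let ?\<Phi> = "\<lambda>z. \<chi> i j. (if i = j then 1 else 0) + X1_inf $ i $ j / z + X2 $ i $ j / z\<^sup>2 + R z $ i $ j"
  have "((\<lambda>z. R z $ i $ j) \<longlongrightarrow> 0) at_infinity" for i j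
  proof -
    have "((\<lambda>z. inverse z ^ 2 * (z ^ 2 * R z $ i $ j)) \<longlongrightarrow> 0 ^ 2 * 0) at_infinity"
      using bigo_powi_tendsto_0[of "\<lambda>z. R z $ i $ j" 2] R[of i j]
      by (intro tendsto_mult tendsto_power tendsto_inverse_0) simp
    moreover have "\<forall>\<^sub>F z in at_infinity. inverse z ^ 2 * (z ^ 2 * R z $ i $ j) = R z $ i $ j"
      using eventually_nonzero_at_infinity by eventually_elim (simp add: power_inverse)
    ultimately show ?thesis
      by (simp add: Lim_transform_eventually)
  qed
  moreover have "((\<lambda>z::complex. a / z ^ n) \<longlongrightarrow> 0) at_infinity" if "n > 0" for a n
  proof -
    have "((\<lambda>z::complex. inverse z ^ n) \<longlongrightarrow> 0) at_infinity"
      using tendsto_power[OF tendsto_inverse_0, of n] that by (simp add: zero_power)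
    from tendsto_mult_right_zero[OF this, of a] show ?thesis
      by (simp add: divide_inverse power_inverse)
  qed
  from this[of 1] this[of 2]
  have "((\<lambda>z::complex. a / z) \<longlongrightarrow> 0) at_infinity" "((\<lambda>z::complex. a / z\<^sup>2) \<longlongrightarrow> 0) at_infinity" for a
    by simp_all
  ultimately have "((\<lambda>z. (if i = j then 1 else 0) + X1_inf $ i $ j / z + X2 $ i $ j / z\<^sup>2 + R z $ i $ j)
      \<longlongrightarrow> (if i = j then 1 else 0) + 0 + 0 + 0) at_infinity" for i j
    by (intro tendsto_add tendsto_const)
  then have "(?\<Phi> \<longlongrightarrow> (\<chi> i j. if i = j then 1 else 0)) at_infinity"
    by (intro tendsto_vec_lambda) simp
  then have "(?\<Phi> \<longlongrightarrow> Finite_Cartesian_Product.mat 1) at_infinity"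
    by (simp add: Finite_Cartesian_Product.mat_def)
  moreover have "\<forall>\<^sub>F z in at_infinity. ?\<Phi> z = X z ** rhp_normalizer m z"
    using X eventually_nonzero_at_infinity
  proof eventually_elim
    case (elim z)
    have "diag3 (z powi (2 * int m)) (z powi (2 * int m - 2)) (z powi (- 4 * int m + 2))
        ** rhp_normalizer m z = Finite_Cartesian_Product.mat 1"
      using elim(2) by (simp add: rhp_normalizer_def diag3_mult power_int_add [symmetric] diag3_one)
    then show ?case
      unfolding elim(1) by (simp add: matrix_mul_assoc [symmetric])
  qed
  ultimately show ?thesis
    by (rule Lim_transform_eventually)
qed

text \<open>The central identity.  When the first \<open>2 * m - 2\<close> moments vanish, the third entry of the row of \<open>p\<close> decays as
fast as the third column of \<open>X\<close>, so the row satisfies the hypotheses of \<open>row_solution_unique\<close>.  Its limit at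
infinity consists of the two leading coefficients of \<open>p\<close> and \<open>- 2\<close> times the next moment.\<close>

proposition rhp_row_eq_combination:
  assumes reg: "plemelj_regular w" and m: "m \<ge> 1" and X: "solves_rhp w m s X"
    and deg: "degree p \<le> 2 * m"
    and van: "\<And>k. k < 2 * m - 2 \<Longrightarrow> circle_mean (\<lambda>\<zeta>. \<zeta> ^ (2 * k) * row_symbol w m s p \<zeta>) = 0"
    and z: "z \<notin> unit_circle"
  shows "rhp_row w m s p z = vector [coeff p (2 * m), coeff p (2 * m - 1),
      - 2 * circle_mean (\<lambda>\<zeta>. \<zeta> ^ (2 * (2 * m - 2)) * row_symbol w m s p \<zeta>)] v* X z"
proof -
  have w: "continuous_on unit_circle w"
    using reg by (simp add: plemelj_regular_def)
  obtain Xp Xm where bv: "boundary_values X Xp Xm"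
    and jump: "\<And>\<zeta>. \<zeta> \<in> unit_circle \<Longrightarrow> Xp \<zeta> = Xm \<zeta> ** jump_matrix w m s \<zeta>"
    using X by (auto simp: solves_rhp_def rhp_jump_def)
  have hol: "(\<lambda>z. X z $ i $ j) holomorphic_on - unit_circle" for i j
    using X by (auto simp: solves_rhp_def rhp_analytic_def)
  obtain yp ym where y_bv: "boundary_values (rhp_row w m s p) yp ym"
    and y_jump: "\<And>\<zeta>. \<zeta> \<in> unit_circle \<Longrightarrow> yp \<zeta> = ym \<zeta> v* jump_matrix w m s \<zeta>"
    using rhp_row_jump[OF reg, where m=m and s=s and p=p] by blast
  have lim: "((\<lambda>z. X z ** rhp_normalizer m z) \<longlongrightarrow> Finite_Cartesian_Product.mat 1) at_infinity"
    using X by (intro rhp_infinity_normalized) (simp add: solves_rhp_def)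
  have lim1: "((\<lambda>z. poly p z * z powi (- 2 * int m)) \<longlongrightarrow> coeff p (2 * m)) at_infinity"
    using tendsto_poly_over_power[OF deg] by simp
  have "((\<lambda>z. poly (odd_quotient p) z * z powi (- int (2 * m - 2)))
      \<longlongrightarrow> coeff (odd_quotient p) (2 * m - 2)) at_infinity"
    by (intro tendsto_poly_over_power degree_odd_quotient deg)
  moreover have "- int (2 * m - 2) = 2 - 2 * int m" "Suc (2 * m - 2) = 2 * m - 1"
    using m by auto
  ultimately have lim2: "((\<lambda>z. sym_quotient p z * z powi (2 - 2 * int m))
      \<longlongrightarrow> coeff p (2 * m - 1)) at_infinity"
    by (simp add: sym_quotient_eq_poly coeff_odd_quotient)
  have exponent: "z powi (4 * int m - 2) = z ^ (2 * (2 * m - 2) + 2)" for z :: complex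
  proof -
    have "4 * int m - 2 = int (2 * (2 * m - 2) + 2)"
      using m by auto
    then show ?thesis
      by (simp only: power_int_of_nat)
  qed
  have lim3: "((\<lambda>z. square_transform (row_symbol w m s p) z * z powi (4 * int m - 2))
      \<longlongrightarrow> - 2 * circle_mean (\<lambda>\<zeta>. \<zeta> ^ (2 * (2 * m - 2)) * row_symbol w m s p \<zeta>)) at_infinity"
    unfolding exponent mult.commute[of "square_transform _ _"]
    by (rule square_transform_asymptotics[OF continuous_row_symbol[OF w]]) (rule van)
  have y_lim: "((\<lambda>z. rhp_row w m s p z v* rhp_normalizer m z) \<longlongrightarrow>
      vector [coeff p (2 * m), coeff p (2 * m - 1),
        - 2 * circle_mean (\<lambda>\<zeta>. \<zeta> ^ (2 * (2 * m - 2)) * row_symbol w m s p \<zeta>)]) at_infinity"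
    unfolding rhp_row_def rhp_normalizer_def vector_3_mult_diag3
    by (intro tendsto_vector_3 lim1 lim2 lim3)
  show ?thesis
    by (rule row_solution_unique[OF hol bv jump lim det_jump_matrix det_rhp_normalizer
          rhp_row_holomorphic[OF w] y_bv y_jump y_lim z])
qed

lemma higher_deriv_poly_at_0: "(deriv ^^ j) (poly p) 0 = fact j * coeff p j" for p :: "complex poly"
proof -
  have "deriv (poly p) = poly (pderiv p)" for p :: "complex poly"
    by (intro ext DERIV_imp_deriv poly_DERIV)
  then have "(deriv ^^ j) (poly p) = poly ((pderiv ^^ j) p)"
    by (induction j) auto
  then show ?thesis
    by (simp add: poly_0_coeff_0 coeff_higher_pderiv pochhammer_fact [symmetric])
qed

lemma vector_matrix_mult_3:
  fixes L :: "complex^3"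
  shows "(L v* A) $ j = L $ 1 * A $ 1 $ j + L $ 2 * A $ 2 $ j + L $ 3 * A $ 3 $ j"
  by (simp add: vector_matrix_mult_def sum_3)

lemma first_column_combination:
  fixes X :: "complex \<Rightarrow> complex^3^3" and L :: "complex^3"
  assumes hol: "\<And>i. (\<lambda>z. X z $ i $ 1) holomorphic_on - unit_circle"
    and eq: "\<And>z. z \<notin> unit_circle \<Longrightarrow> poly p z = (L v* X z) $ 1"
  shows "coeff p j = (\<Sum>i\<in>UNIV. first_column_coeff X j $ i * L $ i)"
proof -
  let ?S = "ball 0 1 :: complex set"
  have off: "?S \<subseteq> - unit_circle"
    by (auto simp: unit_circle_def)
  have hol': "(\<lambda>z. X z $ i $ 1) holomorphic_on ?S" for i
    by (rule holomorphic_on_subset[OF hol off])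
  have "fact j * coeff p j = (deriv ^^ j) (poly p) 0"
    by (simp add: higher_deriv_poly_at_0)
  also have "\<dots> = (deriv ^^ j)
      (\<lambda>z. L $ 1 * X z $ 1 $ 1 + L $ 2 * X z $ 2 $ 1 + L $ 3 * X z $ 3 $ 1) 0"
    by (rule higher_deriv_transform_within_open[where S="?S"])
      (use off in \<open>auto intro!: holomorphic_intros hol' simp: eq vector_matrix_mult_3\<close>)
  also have "\<dots> = L $ 1 * (deriv ^^ j) (\<lambda>z. X z $ 1 $ 1) 0
      + L $ 2 * (deriv ^^ j) (\<lambda>z. X z $ 2 $ 1) 0 + L $ 3 * (deriv ^^ j) (\<lambda>z. X z $ 3 $ 1) 0"
    by (simp add: higher_deriv_add[where S="?S"] higher_deriv_cmult[where A="?S"]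
        holomorphic_intros hol')
  finally show ?thesis
    by (simp add: sum_3 first_column_coeff_def field_simps)
qed

text \<open>When the coefficient of \<open>e3\<close> vanishes, the leading terms cancel and the next ones are governed by \<open>\<phi>\<close>.\<close>

lemma third_column_combination:
  fixes X :: "complex \<Rightarrow> complex^3^3" and L :: "complex^3"
  assumes "rhp_third_column m X \<phi>" and "L $ 3 = 0"
  shows "((\<lambda>z. z powi (4 * int m) * (L v* X z) $ 3) \<longlongrightarrow> (\<Sum>i\<in>UNIV. \<phi> $ i * L $ i)) at_infinity"
proof -
  obtain r :: "complex \<Rightarrow> complex^3" where
    r: "\<And>i. (\<lambda>z. r z $ i) \<in> O[at_infinity](\<lambda>z. z powi (- 4))" and
    col: "\<forall>\<^sub>F z in at_infinity.
      column 3 (X z) = z powi (- 4 * int m + 2) *s (e3 + z powi (- 2) *s \<phi> + r z)"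
    using assms(1) unfolding rhp_third_column_def by blast
  have "((\<lambda>z. z ^ 2 * r z $ i) \<longlongrightarrow> 0) at_infinity" for i
  proof -
    have "((\<lambda>z. inverse z * (z ^ 3 * r z $ i)) \<longlongrightarrow> 0 * 0) at_infinity"
      using bigo_powi_tendsto_0[of "\<lambda>z. r z $ i" 3] r[of i]
      by (intro tendsto_mult tendsto_inverse_0) simp
    moreover have "\<forall>\<^sub>F z in at_infinity. inverse z * (z ^ 3 * r z $ i) = z ^ 2 * r z $ i"
      using eventually_nonzero_at_infinity
      by eventually_elim (simp add: power2_eq_square power3_eq_cube)
    ultimately show ?thesis
      by (simp add: Lim_transform_eventually)
  qed
  then have "((\<lambda>z. \<Sum>i\<in>UNIV. (\<phi> $ i + z ^ 2 * r z $ i) * L $ i)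
      \<longlongrightarrow> (\<Sum>i\<in>UNIV. (\<phi> $ i + 0) * L $ i)) at_infinity"
    by (intro tendsto_intros)
  then have "((\<lambda>z. \<Sum>i\<in>UNIV. (\<phi> $ i + z ^ 2 * r z $ i) * L $ i)
      \<longlongrightarrow> (\<Sum>i\<in>UNIV. \<phi> $ i * L $ i)) at_infinity"
    by simp
  moreover have "\<forall>\<^sub>F z in at_infinity. (\<Sum>i\<in>UNIV. (\<phi> $ i + z ^ 2 * r z $ i) * L $ i)
      = z powi (4 * int m) * (L v* X z) $ 3"
    using col eventually_nonzero_at_infinity
  proof eventually_elim
    case (elim z)
    have X3: "X z $ i $ 3 = z powi (- 4 * int m + 2) * (e3 $ i + z powi (- 2) * \<phi> $ i + r z $ i)" for i
      using arg_cong[OF elim(1), of "\<lambda>v. v $ i"] by (simp add: column_def algebra_simps)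
    have "z powi (4 * int m) * z powi (- 4 * int m + 2) = z ^ 2"
      using elim(2) by (simp add: power_int_add [symmetric])
    moreover have "z ^ 2 * z powi (- 2) = 1"
      using elim(2) by (simp add: power_int_minus)
    ultimately have *: "z powi (4 * int m) * X z $ i $ 3 = z ^ 2 * e3 $ i + \<phi> $ i + z ^ 2 * r z $ i" for i
      unfolding X3 by (simp only: mult.assoc [symmetric] distrib_left mult_1)
    have "z powi (4 * int m) * (L v* X z) $ 3 = (\<Sum>i\<in>UNIV. (z powi (4 * int m) * X z $ i $ 3) * L $ i)"
      by (simp add: vector_matrix_mult_def sum_distrib_left mult_ac)
    also have "\<dots> = (\<Sum>i\<in>UNIV. (z ^ 2 * e3 $ i + \<phi> $ i + z ^ 2 * r z $ i) * L $ i)"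
      by (simp only: *)
    also have "\<dots> = (\<Sum>i\<in>UNIV. (\<phi> $ i + z ^ 2 * r z $ i) * L $ i)"
      using assms(2) by (simp add: sum_3 e3_def)
    finally show ?case ..
  qed
  ultimately show ?thesis
    by (rule Lim_transform_eventually)
qed

section \<open>Nonvanishing determinants and the matrix identity\<close>

lemma rank_3_trivial_kernel:
  fixes a b c L :: "complex^3"
  assumes rank: "rank (of_columns a b c) = 3"
    and zero: "(\<Sum>i\<in>UNIV. a $ i * L $ i) = 0" "(\<Sum>i\<in>UNIV. b $ i * L $ i) = 0"
      "(\<Sum>i\<in>UNIV. c $ i * L $ i) = 0"
  shows "L = 0"
proof -
  let ?V = "vector [a, b, c] :: complex^3^3"
  have "vec.dim (Finite_Cartesian_Product.rows (transpose ?V)) = vec.dimension TYPE(complex) TYPE(3)"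
    using rank by (simp add: of_columns_def row_rank_def_gen vec.dimension_def card_cart_basis)
  then have "vec.span (Finite_Cartesian_Product.rows (transpose ?V)) = UNIV"
    by (simp add: vec.dim_eq_full)
  then obtain B where "B ** transpose ?V = Finite_Cartesian_Product.mat 1"
    using matrix_left_invertible_span_rows_gen by blast
  then have "invertible (transpose ?V)"
    using invertible_left_inverse by blast
  then have "invertible ?V"
    by (simp only: invertible_det_nz Determinants.det_transpose not_False_eq_True)
  then obtain C where C: "C ** ?V = Finite_Cartesian_Product.mat 1"
    using invertible_left_inverse by blast
  have "?V *v L = 0"
    unfolding Finite_Cartesian_Product.vec_eq_iff forall_3
    using zero by (simp add: matrix_vector_mult_def)
  then have "(C ** ?V) *v L = 0"
    by (simp add: matrix_vector_mul_assoc [symmetric])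
  then show ?thesis
    by (simp add: C)
qed

text \<open>A kernel vector of the moment matrix yields a polynomial \<open>p\<close> that vanishes at \<open>0\<close> to order \<open>2 * m - n + 1\<close> and has \<open>n\<close>
vanishing moments.  Its row is \<open>L v* X\<close> with a constant vector \<open>L\<close>.  The zero at the origin makes \<open>L\<close>
orthogonal to the Taylor coefficients \<open>v\<^sub>0, ..., v\<^sub>2\<^sub>m\<^sub>-\<^sub>n\<close> of the first column; each moment beyond the first \<open>2 * m - 2\<close> makes it
orthogonal to \<open>e3\<close> and then to \<open>\<phi>\<close>.  In each of the three cases this gives three orthogonality relations, and
one of the three rank conditions says that they force \<open>L = 0\<close>, hence \<open>p = 0\<close>.\<close>

proposition rhp_E_det_nonzero:
  assumes reg: "plemelj_regular w" and m: "m \<ge> 1" and X: "solves_rhp w m s X"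
    and n: "n \<in> {2 * m, 2 * m - 1, 2 * m - 2}"
  shows "E_det w s n \<noteq> 0"
  unfolding E_det_eq_corner det_corner_nonzero_iff
proof (intro allI impI)
  fix c j
  assume ker: "\<forall>k<n. (\<Sum>j<n. c j * moment_entry w s j k) = 0" and j: "j < n"
  have w: "continuous_on unit_circle w"
    using reg by (simp add: plemelj_regular_def)
  have n_le: "n \<le> 2 * m" and n_ge: "2 * m - 2 \<le> n"
    using n by auto
  \<comment> \<open>Padding with zeros lets kernel vectors of all three sizes be reversed at the same degree \<open>2 * m\<close>.\<close>
  define c' where "c' = (\<lambda>j. if j < n then c j else 0)"
  define p where "p = reversed_poly (2 * m) c'"
  define \<mu> where "\<mu> = (\<lambda>k. circle_mean (\<lambda>\<zeta>. \<zeta> ^ (2 * k) * row_symbol w m s p \<zeta>))"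
  have \<mu>: "\<mu> k = 0" if "k < n" for k
  proof -
    have "\<mu> k = (\<Sum>j\<le>2 * m. c' j * moment_entry w s j k)"
      by (simp add: \<mu>_def p_def row_symbol_moment[OF w])
    also have "\<dots> = (\<Sum>j<n. c' j * moment_entry w s j k)"
      using n_le by (intro sum.mono_neutral_right) (auto simp: c'_def)
    also have "\<dots> = 0"
      using ker that by (simp add: c'_def)
    finally show ?thesis .
  qed
  define L :: "complex^3" where
    "L = vector [coeff p (2 * m), coeff p (2 * m - 1), - 2 * \<mu> (2 * m - 2)]"
  have row: "rhp_row w m s p z = L v* X z" if "z \<notin> unit_circle" for z
    unfolding L_def \<mu>_def
    by (rule rhp_row_eq_combination[OF reg m X _ _ that])
      (use \<mu> n_ge in \<open>auto simp: \<mu>_def p_def degree_reversed_poly\<close>)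
  have hol: "(\<lambda>z. X z $ i $ 1) holomorphic_on - unit_circle" for i
    using X by (auto simp: solves_rhp_def rhp_analytic_def)
  have p_eq: "poly p z = (L v* X z) $ 1" if "z \<notin> unit_circle" for z
    using arg_cong[OF row[OF that], of "\<lambda>v::complex^3. v $ 1"] by (simp add: rhp_row_def)
  have T_eq: "square_transform (row_symbol w m s p) z = (L v* X z) $ 3" if "z \<notin> unit_circle" for z
    using arg_cong[OF row[OF that], of "\<lambda>v::complex^3. v $ 3"] by (simp add: rhp_row_def)
  have coeffs: "coeff p i = (\<Sum>k\<in>UNIV. first_column_coeff X i $ k * L $ k)" for i
    by (rule first_column_combination[OF hol p_eq])
  have low: "(\<Sum>k\<in>UNIV. first_column_coeff X i $ k * L $ k) = 0" if "i \<le> 2 * m - n" for i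
    unfolding coeffs[symmetric] using that n_le by (auto simp: p_def coeff_reversed_poly c'_def)
  obtain \<phi> where third: "rhp_third_column m X \<phi>" and rk: "rhp_rank X \<phi>"
    using X by (auto simp: solves_rhp_def)
  have e3_L: "(\<Sum>k\<in>UNIV. e3 $ k * L $ k) = 0" if "2 * m - 2 < n"
    using \<mu>[OF that] by (simp add: sum_3 e3_def L_def)
  have "L = 0"
  proof -
    consider "n = 2 * m" | "n = 2 * m - 1" "n \<noteq> 2 * m" | "n = 2 * m - 2"
      using n by auto
    then show ?thesis
    proof cases
      case 1
      have L3: "L $ 3 = 0"
        using \<mu>[of "2 * m - 2"] 1 m by (simp add: L_def)
      \<comment> \<open>Both sides are the limit of the third entry of the row, scaled by \<open>z ^ (4 * m)\<close>.\<close>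
      have "(\<Sum>k\<in>UNIV. \<phi> $ k * L $ k) = - 2 * \<mu> (2 * m - 1)"
      proof (rule tendsto_unique[OF trivial_limit_at_infinity])
        show "((\<lambda>z. z powi (4 * int m) * (L v* X z) $ 3) \<longlongrightarrow> (\<Sum>k\<in>UNIV. \<phi> $ k * L $ k)) at_infinity"
          by (rule third_column_combination[OF third L3])
        have "((\<lambda>z. z ^ (2 * (2 * m - 1) + 2) * square_transform (row_symbol w m s p) z)
            \<longlongrightarrow> - 2 * \<mu> (2 * m - 1)) at_infinity"
          unfolding \<mu>_def using \<mu> 1
          by (intro square_transform_asymptotics continuous_row_symbol w) (simp add: \<mu>_def)
        moreover have "\<forall>\<^sub>F z in at_infinity. z ^ (2 * (2 * m - 1) + 2) *
            square_transform (row_symbol w m s p) z = z powi (4 * int m) * (L v* X z) $ 3"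
          using not_in_unit_circle_at_infinity
        proof eventually_elim
          case (elim z)
          have "4 * int m = int (2 * (2 * m - 1) + 2)"
            using m by auto
          then have "z powi (4 * int m) = z ^ (2 * (2 * m - 1) + 2)"
            by (simp only: power_int_of_nat)
          then show ?case
            by (simp only: T_eq[OF elim])
        qed
        ultimately show "((\<lambda>z. z powi (4 * int m) * (L v* X z) $ 3)
            \<longlongrightarrow> - 2 * \<mu> (2 * m - 1)) at_infinity"
          by (rule Lim_transform_eventually)
      qed
      also have "\<dots> = 0"
        using \<mu>[of "2 * m - 1"] 1 m by simp
      finally have phi_L: "(\<Sum>k\<in>UNIV. \<phi> $ k * L $ k) = 0" .
      show ?thesis
        by (rule rank_3_trivial_kernel[of "first_column_coeff X 0" e3 \<phi>])
          (use rk low[of 0] e3_L phi_L 1 m in \<open>auto simp: rhp_rank_def Let_def\<close>)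
    next
      case 2
      then show ?thesis
        by (intro rank_3_trivial_kernel[of "first_column_coeff X 0" "first_column_coeff X 1" e3])
          (use rk low[of 0] low[of 1] e3_L m in \<open>auto simp: rhp_rank_def Let_def\<close>)
    next
      case 3
      then show ?thesis
        by (intro rank_3_trivial_kernel[of "first_column_coeff X 0" "first_column_coeff X 1"
              "first_column_coeff X 2"])
          (use rk low[of 0] low[of 1] low[of 2] m in \<open>auto simp: rhp_rank_def Let_def\<close>)
    qed
  qed
  then have "coeff p (2 * m - j) = 0"
    by (simp add: coeffs)
  then show "c j = 0"
    using j n_le by (simp add: p_def coeff_reversed_poly c'_def)
qed

text \<open>The central identity applied to \<open>p = z ^ (2 * m) * S_n (1 / z)\<close>.  The limit vector is the row of \<open>B_matrix\<close>: the
leading coefficients of \<open>p\<close> are \<open>S_n(0)\<close> and \<open>S_n'(0)\<close>, and the moment of index \<open>2 * m - 2\<close> vanishes by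
orthogonality unless \<open>n = 2 * m - 2\<close>, when it is \<open>g_coeff\<close>.\<close>

proposition rhp_S_row:
  assumes reg: "plemelj_regular w" and m: "m \<ge> 1" and X: "solves_rhp w m s X"
    and n: "2 * m - 2 \<le> n" "n \<le> 2 * m" and z: "z \<notin> unit_circle"
    and E: "E_det w s n \<noteq> 0"
  shows "vector [z ^ (2 * m - n) * poly (S_star w s n) z,
        sym_quotient (monom 1 (2 * m - n) * S_star w s n) z, H_fun w s n z]
    = vector [poly (S_poly w s n) 0, poly (pderiv (S_poly w s n)) 0,
        if n = 2 * m - 2 then - 2 * g_coeff w s n else 0] v* X z"
proof -
  have w: "continuous_on unit_circle w"
    using reg by (simp add: plemelj_regular_def)
  let ?S = "S_poly w s n"
  have S: "is_S_poly w s n ?S"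
    by (rule is_S_poly_S_poly[OF w E])
  then have deg: "degree ?S = n"
    by (simp add: is_S_poly_def)
  define p where "p = reversed_poly (2 * m) (coeff ?S)"
  have p: "p = monom 1 (2 * m - n) * S_star w s n"
    unfolding p_def S_star_def by (rule reversed_poly_coeff[OF deg n(2)])
  have moments: "circle_mean (\<lambda>\<zeta>. \<zeta> ^ (2 * k) * row_symbol w m s p \<zeta>)
      = (\<Sum>j\<le>n. coeff ?S j * moment_entry w s j k)" for k
    unfolding p_def row_symbol_moment[OF w] using n deg
    by (intro sum.mono_neutral_right) (auto intro: coeff_eq_0)
  have vanish: "circle_mean (\<lambda>\<zeta>. \<zeta> ^ (2 * k) * row_symbol w m s p \<zeta>) = 0" if "k < n" for k
    using S that by (simp add: moments is_S_poly_def circle_mean_poly_inverse[OF w] deg)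
  have last: "- 2 * circle_mean (\<lambda>\<zeta>. \<zeta> ^ (2 * (2 * m - 2)) * row_symbol w m s p \<zeta>)
      = (if n = 2 * m - 2 then - 2 * g_coeff w s n else 0)"
  proof (cases "n = 2 * m - 2")
    case True
    then show ?thesis
      using S_poly_next_moment[OF w E] by (simp add: moments)
  qed (use vanish[of "2 * m - 2"] n in auto)
  have symbol: "row_symbol w m s p \<zeta> = poly ?S (inverse \<zeta>) * w \<zeta> * \<zeta> powi (- s)"
    if "\<zeta> \<in> unit_circle" for \<zeta>
  proof -
    have nz: "\<zeta> \<noteq> 0"
      using that by (auto simp: unit_circle_def)
    have "\<zeta> powi (- 2 * int m - s) * \<zeta> ^ (2 * m)
        = \<zeta> powi (- 2 * int m - s + int (2 * m))"
      using nz by (simp only: power_int_add power_int_of_nat simp_thms)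
    also have "- 2 * int m - s + int (2 * m) = - s"
      by simp
    finally have "\<zeta> powi (- 2 * int m - s) * (\<zeta> ^ (2 * m) * a) = \<zeta> powi (- s) * a" for a
      by (simp only: mult.assoc [symmetric])
    then show ?thesis
      unfolding row_symbol_def p_def poly_reversed_poly_coeff[of ?S "2 * m", OF _ nz, unfolded deg, OF n(2)]
      by (simp only: mult_ac)
  qed
  have H: "square_transform (row_symbol w m s p) z = H_fun w s n z"
    using square_transform_cong[OF symbol] by (simp add: square_transform_def H_fun_def fun_eq_iff)
  have "rhp_row w m s p z = vector [coeff p (2 * m), coeff p (2 * m - 1),
      - 2 * circle_mean (\<lambda>\<zeta>. \<zeta> ^ (2 * (2 * m - 2)) * row_symbol w m s p \<zeta>)] v* X z"
    by (rule rhp_row_eq_combination[OF reg m X _ _ z])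
      (use vanish n in \<open>auto simp: p_def degree_reversed_poly\<close>)
  moreover have "coeff p (2 * m) = poly ?S 0" "coeff p (2 * m - 1) = poly (pderiv ?S) 0"
    using m by (simp_all add: p_def coeff_reversed_poly poly_0_coeff_0 coeff_pderiv)
  ultimately have "vector [poly p z, sym_quotient p z, H_fun w s n z]
    = vector [poly ?S 0, poly (pderiv ?S) 0, if n = 2 * m - 2 then - 2 * g_coeff w s n else 0] v* X z"
    by (simp only: last rhp_row_def H)
  then show ?thesis
    by (simp only: p poly_mult poly_monom mult_1)
qed

lemma vector_3_matrix_mult:
  fixes a b c :: "complex^3"
  shows "(vector [a, b, c] :: complex^3^3) ** X = vector [a v* X, b v* X, c v* X]"
  unfolding Finite_Cartesian_Product.vec_eq_iff forall_3
  by (simp add: matrix_matrix_mult_def vector_matrix_mult_def mult.commute)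

proposition S_H_matrix_eq:
  assumes reg: "plemelj_regular w" and m: "m \<ge> 1" and X: "solves_rhp w m s X"
    and z: "z \<notin> unit_circle"
    and E: "\<And>n. n \<in> {2 * m, 2 * m - 1, 2 * m - 2} \<Longrightarrow> E_det w s n \<noteq> 0"
  shows "S_H_matrix w m s z = B_matrix w m s ** X z"
proof -
  have diff: "2 * m - (2 * m - 1) = 1" "2 * m - (2 * m - 2) = 2" "2 * m - 1 \<noteq> 2 * m - 2"
      "2 * m \<noteq> 2 * m - 2"
    using m by auto
  note row = rhp_S_row[OF reg m X _ _ z E]
  have quotient_1: "sym_quotient (monom 1 1 * p) z = (poly p z + poly p (- z)) / 2" for p
    by (cases "z = 0")
      (simp add: sym_quotient_def poly_0_coeff_0 coeff_pderiv coeff_monom_mult,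
        simp add: sym_quotient_def poly_monom field_simps)
  have quotient_2: "sym_quotient (monom 1 2 * p) z = z / 2 * (poly p z - poly p (- z))" for p
    by (cases "z = 0")
      (simp add: sym_quotient_def poly_0_coeff_0 coeff_pderiv coeff_monom_mult,
        simp add: sym_quotient_def poly_monom field_simps power2_eq_square)
  show ?thesis
    unfolding B_matrix_def vector_3_matrix_mult S_H_matrix_def
    using row[of "2 * m"] row[of "2 * m - 1"] row[of "2 * m - 2"] diff
    by (simp add: quotient_1[unfolded One_nat_def] quotient_2)
qed

text \<open>If \<open>d v* B = 0\<close>, the first column of the matrix identity reads
\<open>d\<^sub>1 S*\<^sub>2\<^sub>m + d\<^sub>2 z S*\<^sub>2\<^sub>m\<^sub>-\<^sub>1 + d\<^sub>3 z\<^sup>2 S*\<^sub>2\<^sub>m\<^sub>-\<^sub>2 = 0\<close>.  Reversed monic polynomials equal 1 at \<open>0\<close>, so the coefficients of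
\<open>1\<close>, \<open>z\<close> and \<open>z\<^sup>2\<close> give \<open>d = 0\<close> one after another.\<close>

proposition B_matrix_invertible:
  assumes w: "continuous_on unit_circle w" and m: "m \<ge> 1"
    and E: "\<And>n. n \<in> {2 * m, 2 * m - 1, 2 * m - 2} \<Longrightarrow> E_det w s n \<noteq> 0"
    and eq: "\<And>z. z \<notin> unit_circle \<Longrightarrow> S_H_matrix w m s z = B_matrix w m s ** X z"
  shows "invertible (B_matrix w m s)"
proof -
  let ?S = "\<lambda>n. S_star w s n"
  have lead: "coeff (?S n) 0 = 1" if "n \<in> {2 * m, 2 * m - 1, 2 * m - 2}" for n
    using is_S_poly_S_poly[OF w E[OF that]] by (auto simp: S_star_def is_S_poly_def)
  have ker: "d = 0" if d: "d v* B_matrix w m s = 0" for d :: "complex^3"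
  proof -
    define P where "P = Polynomial.smult (d $ 1) (?S (2 * m)) + Polynomial.smult (d $ 2) (monom 1 1 * ?S (2 * m - 1))
        + Polynomial.smult (d $ 3) (monom 1 2 * ?S (2 * m - 2))"
    have "poly P z = 0" if "z \<notin> unit_circle" for z
    proof -
      have "d v* S_H_matrix w m s z = 0"
        unfolding eq[OF that] by (simp add: vector_matrix_mul_assoc [symmetric] d)
      then have "(d v* S_H_matrix w m s z) $ 1 = 0"
        by simp
      then show ?thesis
        by (simp add: vector_matrix_mult_3 S_H_matrix_def P_def poly_monom)
    qed
    then have "ball 0 1 \<subseteq> {z. poly P z = 0}"
      by (auto simp: unit_circle_def)
    moreover have "infinite (ball (0::complex) 1)"
      using uncountable_ball[of 1 "0::complex"] countable_finite by auto
    ultimately have "infinite {z. poly P z = 0}"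
      using finite_subset by blast
    then have "P = 0"
      using poly_roots_finite by blast
    then have cP: "coeff P i = 0" for i
      by simp
    have d1: "d $ 1 = 0"
      using cP[of 0] lead[of "2 * m"] by (simp add: P_def coeff_monom_mult)
    have d2: "d $ 2 = 0"
      using cP[of 1] lead[of "2 * m - 1"] d1 by (simp add: P_def coeff_monom_mult)
    have d3: "d $ 3 = 0"
      using cP[of 2] lead[of "2 * m - 2"] d1 d2 by (simp add: P_def coeff_monom_mult)
    show ?thesis
      unfolding Finite_Cartesian_Product.vec_eq_iff forall_3 using d1 d2 d3 by simp
  qed
  have "\<exists>C. C ** transpose (B_matrix w m s) = Finite_Cartesian_Product.mat 1"
    unfolding matrix_left_invertible_ker using ker by simp
  then have "invertible (transpose (B_matrix w m s))"
    using invertible_left_inverse by blast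
  then show ?thesis
    by (simp only: invertible_det_nz Determinants.det_transpose not_False_eq_True)
qed

text \<open>Cramer's rule for the values \<open>S_n(0)\<close> and \<open>S_n'(0)\<close>; the signs come from the parity of \<open>n\<close>.\<close>

lemma det_B_matrix:
  assumes w: "continuous_on unit_circle w" and m: "m \<ge> 1"
    and E: "E_det w s (2 * m) \<noteq> 0" "E_det w s (2 * m - 1) \<noteq> 0"
  shows "Determinants.det (B_matrix w m s) = - 2 * g_coeff w s (2 * m - 2) *
    ((E_det w (s + 1) (2 * m) * Ehat_det w s (2 * m - 1)
        - E_det w (s + 1) (2 * m - 1) * Ehat_det w s (2 * m))
      / (E_det w s (2 * m) * E_det w s (2 * m - 1)))"
proof -
  have signs: "(- 1 :: complex) ^ (2 * m - 1) = - 1" "(- 1 :: complex) ^ (2 * m - 1 + 1) = 1"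
    using m by (simp_all add: minus_one_power_iff)
  have at_0: "poly (S_poly w s (2 * m)) 0 = E_det w (s + 1) (2 * m) / E_det w s (2 * m)"
    "poly (pderiv (S_poly w s (2 * m))) 0 = - Ehat_det w s (2 * m) / E_det w s (2 * m)"
    "poly (S_poly w s (2 * m - 1)) 0 = - E_det w (s + 1) (2 * m - 1) / E_det w s (2 * m - 1)"
    "poly (pderiv (S_poly w s (2 * m - 1))) 0 = Ehat_det w s (2 * m - 1) / E_det w s (2 * m - 1)"
    using S_poly_at_0[OF w E(1)] S_poly_deriv_at_0[OF w E(1)] S_poly_at_0[OF w E(2)]
      S_poly_deriv_at_0[OF w E(2)] m
    by (simp_all add: signs[simplified])
  show ?thesis
    unfolding B_matrix_def Determinants.det_3 at_0 using E by (simp add: field_simps)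
qed

theorem theorem6:
  fixes w :: "complex \<Rightarrow> complex" and m :: nat and s :: int and X :: "complex \<Rightarrow> complex^3^3"
  assumes "plemelj_regular w" and "m \<ge> 1"
  shows
    "(solves_rhp w m s X \<longrightarrow>
        E_det w s (2*m) * E_det w s (2*m - 1) * E_det w s (2*m - 2) \<noteq> 0 \<and>
        (\<forall>n\<in>{2*m, 2*m - 1, 2*m - 2}. \<exists>!p. is_S_poly w s n p) \<and>
        invertible (B_matrix w m s) \<and>
        (E_det w (s + 1) (2*m) * Ehat_det w s (2*m - 1)
           - E_det w (s + 1) (2*m - 1) * Ehat_det w s (2*m))
          / (E_det w s (2*m) * E_det w s (2*m - 1)) \<noteq> 0 \<and>
        (\<forall>z. z \<notin> unit_circle \<longrightarrow> S_H_matrix w m s z = B_matrix w m s ** X z))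
     \<and>
     (E_det w s (2*m) * E_det w s (2*m - 1) * E_det w s (2*m - 2) \<noteq> 0 \<longrightarrow>
        (invertible (B_matrix w m s) \<longleftrightarrow>
         (E_det w (s + 1) (2*m) * Ehat_det w s (2*m - 1)
            - E_det w (s + 1) (2*m - 1) * Ehat_det w s (2*m))
           / (E_det w s (2*m) * E_det w s (2*m - 1)) \<noteq> 0))"
proof -
  have w: "continuous_on unit_circle w"
    using assms(1) by (simp add: plemelj_regular_def)
  let ?E = "E_det w s (2*m) * E_det w s (2*m - 1) * E_det w s (2*m - 2) \<noteq> 0"
  let ?ratio = "(E_det w (s + 1) (2*m) * Ehat_det w s (2*m - 1)
            - E_det w (s + 1) (2*m - 1) * Ehat_det w s (2*m))
           / (E_det w s (2*m) * E_det w s (2*m - 1))"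
  have equiv: "invertible (B_matrix w m s) \<longleftrightarrow> ?ratio \<noteq> 0" if ?E
  proof -
    from that have E: "E_det w s (2*m) \<noteq> 0" "E_det w s (2*m - 1) \<noteq> 0" "E_det w s (2*m - 2) \<noteq> 0"
      by auto
    have "2 * m - 2 + 1 = 2 * m - 1"
      using assms(2) by simp
    then have "g_coeff w s (2*m - 2) \<noteq> 0"
      using E by (simp add: g_coeff_def)
    then show ?thesis
      unfolding invertible_det_nz det_B_matrix[OF w assms(2) E(1,2)]
      by simp
  qed
  {
    assume X: "solves_rhp w m s X"
    have E: "E_det w s n \<noteq> 0" if "n \<in> {2*m, 2*m - 1, 2*m - 2}" for n
      by (rule rhp_E_det_nonzero[OF assms X that])
    have eq: "S_H_matrix w m s z = B_matrix w m s ** X z" if "z \<notin> unit_circle" for z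
      by (rule S_H_matrix_eq[OF assms X that E])
    have inv: "invertible (B_matrix w m s)"
      by (rule B_matrix_invertible[OF w assms(2) E eq])
    have all_E: ?E
      using E by simp
    have "\<exists>!p. is_S_poly w s n p" if "n \<in> {2*m, 2*m - 1, 2*m - 2}" for n
      by (rule S_poly_exists_unique[OF w E[OF that]])
    with all_E inv equiv[OF all_E] eq have "?E \<and>
        (\<forall>n\<in>{2*m, 2*m - 1, 2*m - 2}. \<exists>!p. is_S_poly w s n p) \<and>
        invertible (B_matrix w m s) \<and> ?ratio \<noteq> 0 \<and>
        (\<forall>z. z \<notin> unit_circle \<longrightarrow> S_H_matrix w m s z = B_matrix w m s ** X z)"
      by blast
  }
  with equiv show ?thesis
    by blast
qed

end
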